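(* Let $d$ be a positive integer and let $D$ be a non-empty subset of $\mathbb{Z}/d\mathbb{Z}$. If $K$ is an oriented classical knot (a link with one component), then $$\Theta_{d,D}(q,z)(K)=\Theta_{1,\{0\}}(q,z|D|)(K)=P(q,z|D|)(K).$$
   Context: Let $B_n$ be the braid group on $n$ strands with standard generators $\sigma_1,\dots,\sigma_{n-1}$, and let $q\in\mathbb{C}\setminus\{0\}$. The Yokonuma--Hecke algebra $Y_{d,n}(q)$ is the $\mathbb{C}$-algebra generated by $g_1,\dots,g_{n-1},t_1,\dots,t_n$ with relations: $g_ig_jg_i=g_jg_ig_j$ for $|i-j|=1$; $g_ig_j=g_jg_i$ for $|i-j|>1$; $t_it_j=t_jt_i$; $t_jg_i=g_it_{s_i(j)}$ where $s_i=(i,i+1)$; $t_j^d=1$; and $g_i^2=1+(q-q^{-1})e_ig_i$, where $e_i=\frac1d\sum_{s=0}^{d-1}t_i^st_{i+1}^{d-s}$. Set $Y_{d,0}(q)=\mathbb{C}$; there are natural inclusions $Y_{d,n}(q)\subset Y_{d,n+1}(q)$. For a non-empty $D\subseteq\mathbb{Z}/d\mathbb{Z}$, let $X_D=(\mathrm{x}_1,\dots,\mathrm{x}_{d-1})$ be the solution of the E-system $\sum_{s=0}^{d-1}x_{k+s}x_{d-s}=x_k\sum_{s=0}^{d-1}x_sx_{d-s}$ ($1\le k\le d-1$, indices modulo $d$, $x_0=1$) parametrized by $D$, namely $\mathrm{x}_k=\frac{1}{|D|}\sum_{m\in D}\exp(2\pi\sqrt{-1}\,km/d)$. Let $z$ be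 an indeterminate. The specialized trace $\mathrm{tr}_{d,D}:\bigcup_{n\ge0}Y_{d,n}(q)\to\mathbb{C}[z]$ is the unique linear map with, for all $n$ and all $a,b\in Y_{d,n}(q)$: $\mathrm{tr}_{d,D}(ab)=\mathrm{tr}_{d,D}(ba)$; $\mathrm{tr}_{d,D}(1)=1$; $\mathrm{tr}_{d,D}(ag_n)=z\,\mathrm{tr}_{d,D}(a)$; $\mathrm{tr}_{d,D}(at_{n+1}^k)=\mathrm{x}_k\,\mathrm{tr}_{d,D}(a)$ for $1\le k\le d-1$. One has $E_D:=\mathrm{tr}_{d,D}(e_i)=1/|D|$. For $\alpha\in B_n$, $\mathrm{tr}_{d,D}(\alpha)$ denotes the trace of the image of $\alpha$ under $\sigma_i\mapsto g_i$. Set $\lambda_D=\frac{z-(q-q^{-1})E_D}{z}$ and $\Lambda_D=\frac{1}{z\sqrt{\lambda_D}}$. For $\alpha\in B_n$ with closure $\widehat\alpha$ and exponent sum $\epsilon(\alpha)$, the isotopy invariant $\Theta_{d,D}=\Theta_{d,D}(q,z)$ of oriented classical links is $$\Theta_{d,D}(\widehat\alpha)=\Lambda_D^{n-1}(\sqrt{\lambda_D})^{\epsilon(\alpha)}\,\mathrm{tr}_{d,D}(\alpha).$$ The Homflypt polynomial is $P(q,z)=\Theta_{1,\{0\}}(q,z)$. $P(q,z|D|)$ and $\Theta_{1,\{0\}}(q,z|D|)$ denote the result of substituting $z|D|$ for $z$; under this substitution $\lambda_{\{0\}}=\frac{z-(q-q^{-1})}{z}$ becomes $\lambda_D$, and the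 same square root $\sqrt{\lambda_D}$ is used on both sides. *)

theory Defs
  imports
    "HOL-Analysis.Analysis"
    "HOL-Algebra.QuotRing"
    "HOL-Algebra.Algebraic_Closure_Type"
    "HOL-Combinatorics.Transposition"
    "HOL-Library.Poly_Mapping"
begin

section \<open>Free algebras\<close>

text \<open>
  The monoid of words is wrapped in a type of its own so that finitely supported functions on it
  carry the convolution product of \<^theory>\<open>HOL-Library.Poly_Mapping\<close>; that product is the one of
  the free associative algebra.
\<close>

datatype 'a free_monoid = Word (letters: "'a list")

instantiation free_monoid :: (type) monoid_add
begin

definition zero_free_monoid :: "'a free_monoid"
  where "0 = Word []"

definition plus_free_monoid :: "'a free_monoid \<Rightarrow> 'a free_monoid \<Rightarrow> 'a free_monoid"
  where "u + v = Word (letters u @ letters v)"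

instance
  by standard (simp_all add: zero_free_monoid_def plus_free_monoid_def)

end

type_synonym 'a free_alg = "'a free_monoid \<Rightarrow>\<^sub>0 complex"

definition fa_gen :: "'a \<Rightarrow> 'a free_alg"
  where "fa_gen x = Poly_Mapping.single (Word [x]) 1"

definition fa_scalar :: "complex \<Rightarrow> 'a free_alg"
  where "fa_scalar c = Poly_Mapping.single 0 c"

text \<open>The free algebra on the generators in \<open>S\<close>, inside the one on all elements of the type.\<close>

definition free_alg_on :: "'a set \<Rightarrow> 'a free_alg ring"
  where "free_alg_on S =
    \<lparr>carrier = {a. \<forall>w\<in>Poly_Mapping.keys a. set (letters w) \<subseteq> S},
     mult = (*), one = 1, zero = 0, add = (+)\<rparr>"

lemma ring_free_alg_on: "ring (free_alg_on S)"
proof (rule ringI)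
  show "abelian_group (free_alg_on S)"
  proof (rule abelian_groupI)
    fix x assume x: "x \<in> carrier (free_alg_on S)"
    have "- x \<in> carrier (free_alg_on S)"
      using x by (simp add: free_alg_on_def)
    then show "\<exists>y\<in>carrier (free_alg_on S). y \<oplus>\<^bsub>free_alg_on S\<^esub> x = \<zero>\<^bsub>free_alg_on S\<^esub>"
      by (intro bexI[of _ "- x"]) (simp_all add: free_alg_on_def)
  qed (use Poly_Mapping.keys_add in \<open>fastforce simp: free_alg_on_def add_ac\<close>)+
  show "monoid (free_alg_on S)"
  proof (rule monoidI)
    fix x y assume xy: "x \<in> carrier (free_alg_on S)" "y \<in> carrier (free_alg_on S)"
    have "set (letters w) \<subseteq> S" if w: "w \<in> Poly_Mapping.keys (x * y)" for w
    proof -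
      obtain u v where "w = u + v" "u \<in> Poly_Mapping.keys x" "v \<in> Poly_Mapping.keys y"
        using w keys_mult[of x y] by blast
      then show ?thesis
        using xy by (auto simp: free_alg_on_def plus_free_monoid_def)
    qed
    then show "x \<otimes>\<^bsub>free_alg_on S\<^esub> y \<in> carrier (free_alg_on S)"
      by (simp add: free_alg_on_def)
  qed (simp_all add: free_alg_on_def zero_free_monoid_def mult.assoc)
qed (simp_all add: free_alg_on_def algebra_simps)


section \<open>The Yokonuma--Hecke algebras\<close>

datatype yh_gen = G nat | T nat

abbreviation yh_g :: "nat \<Rightarrow> yh_gen free_alg"
  where "yh_g i \<equiv> fa_gen (G i)"

abbreviation yh_t :: "nat \<Rightarrow> yh_gen free_alg"
  where "yh_t j \<equiv> fa_gen (T j)"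

definition yh_e :: "nat \<Rightarrow> nat \<Rightarrow> yh_gen free_alg"
  where "yh_e d i = fa_scalar (1 / of_nat d) * (\<Sum>s<d. yh_t i ^ s * yh_t (i + 1) ^ (d - s))"

definition yh_free :: "nat \<Rightarrow> yh_gen free_alg ring"
  where "yh_free n = free_alg_on (G ` {1..<n} \<union> T ` {1..n})"

inductive yh_rel :: "nat \<Rightarrow> complex \<Rightarrow> nat \<Rightarrow> yh_gen free_alg \<Rightarrow> yh_gen free_alg \<Rightarrow> bool"
  for d :: nat and q :: complex and n :: nat
where
  braid: "i \<in> {1..<n} \<Longrightarrow> j \<in> {1..<n} \<Longrightarrow> \<bar>int i - int j\<bar> = 1 \<Longrightarrow>
    yh_rel d q n (yh_g i * yh_g j * yh_g i) (yh_g j * yh_g i * yh_g j)"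
| far_comm: "i \<in> {1..<n} \<Longrightarrow> j \<in> {1..<n} \<Longrightarrow> \<bar>int i - int j\<bar> > 1 \<Longrightarrow>
    yh_rel d q n (yh_g i * yh_g j) (yh_g j * yh_g i)"
| t_comm: "i \<in> {1..n} \<Longrightarrow> j \<in> {1..n} \<Longrightarrow>
    yh_rel d q n (yh_t i * yh_t j) (yh_t j * yh_t i)"
| t_g: "i \<in> {1..<n} \<Longrightarrow> j \<in> {1..n} \<Longrightarrow>
    yh_rel d q n (yh_t j * yh_g i) (yh_g i * yh_t (Transposition.transpose i (i + 1) j))"
| t_order: "j \<in> {1..n} \<Longrightarrow>
    yh_rel d q n (yh_t j ^ d) 1"
| quadratic: "i \<in> {1..<n} \<Longrightarrow>
    yh_rel d q n (yh_g i ^ 2) (1 + fa_scalar (q - inverse q) * yh_e d i * yh_g i)"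

definition yh_ideal :: "nat \<Rightarrow> complex \<Rightarrow> nat \<Rightarrow> yh_gen free_alg set"
  where "yh_ideal d q n = genideal (yh_free n) {a - b | a b. yh_rel d q n a b}"

text \<open>
  For \<open>n = 0\<close> there are neither generators nor relations, so \<open>yh d q 0\<close> is the field of complex
  numbers.
\<close>

definition yh :: "nat \<Rightarrow> complex \<Rightarrow> nat \<Rightarrow> yh_gen free_alg set ring"
  where "yh d q n = yh_free n Quot yh_ideal d q n"

definition yh_class :: "nat \<Rightarrow> complex \<Rightarrow> nat \<Rightarrow> yh_gen free_alg \<Rightarrow> yh_gen free_alg set"
  where "yh_class d q n a = yh_ideal d q n +>\<^bsub>yh_free n\<^esub> a"

text \<open>
  The natural map from \<open>yh d q n\<close> to \<open>yh d q (n + 1)\<close>: all representatives of a class have the same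
  class at the next level, and the union only serves to pick that class.
\<close>

definition yh_incl :: "nat \<Rightarrow> complex \<Rightarrow> nat \<Rightarrow> yh_gen free_alg set \<Rightarrow> yh_gen free_alg set"
  where "yh_incl d q n x = (\<Union>a\<in>x. yh_class d q (n + 1) a)"


section \<open>The specialized trace\<close>

text \<open>A subset of \<open>\<int>/d\<int>\<close> is given by its set of representatives in \<open>{0..<d}\<close>.\<close>

definition E_sol :: "nat \<Rightarrow> nat set \<Rightarrow> nat \<Rightarrow> complex"
  where "E_sol d D k =
    1 / of_nat (card D) * (\<Sum>m\<in>D. exp (2 * of_real pi * \<i> * of_nat k * of_nat m / of_nat d))"

text \<open>
  A function on the union of the \<open>yh d q n\<close> is a family of functions, one for each \<open>n\<close>,
  compatible with the natural maps. The indeterminate \<open>z\<close> is the polynomial \<open>[:0, 1:]\<close>.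
\<close>

definition specialized_trace ::
    "nat \<Rightarrow> nat set \<Rightarrow> complex \<Rightarrow> (nat \<Rightarrow> yh_gen free_alg set \<Rightarrow> complex poly) \<Rightarrow> bool"
  where "specialized_trace d D q tr \<longleftrightarrow>
    (\<forall>n. \<forall>a\<in>carrier (yh d q n). tr (n + 1) (yh_incl d q n a) = tr n a) \<and>
    (\<forall>n. \<forall>a\<in>carrier (yh d q n). \<forall>b\<in>carrier (yh d q n).
       tr n (a \<oplus>\<^bsub>yh d q n\<^esub> b) = tr n a + tr n b) \<and>
    (\<forall>n c. \<forall>a\<in>carrier (yh d q n).
       tr n (yh_class d q n (fa_scalar c) \<otimes>\<^bsub>yh d q n\<^esub> a) = Polynomial.smult c (tr n a)) \<and>
    (\<forall>n. \<forall>a\<in>carrier (yh d q n). \<forall>b\<in>carrier (yh d q n).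
       tr n (a \<otimes>\<^bsub>yh d q n\<^esub> b) = tr n (b \<otimes>\<^bsub>yh d q n\<^esub> a)) \<and>
    (\<forall>n. tr n \<one>\<^bsub>yh d q n\<^esub> = 1) \<and>
    (\<forall>n\<ge>1. \<forall>a\<in>carrier (yh d q n).
       tr (n + 1) (yh_incl d q n a \<otimes>\<^bsub>yh d q (n + 1)\<^esub> yh_class d q (n + 1) (yh_g n))
         = [:0, 1:] * tr n a) \<and>
    (\<forall>n. \<forall>a\<in>carrier (yh d q n). \<forall>k\<in>{1..d - 1}.
       tr (n + 1) (yh_incl d q n a \<otimes>\<^bsub>yh d q (n + 1)\<^esub> yh_class d q (n + 1) (yh_t (n + 1) ^ k))
         = Polynomial.smult (E_sol d D k) (tr n a))"


section \<open>Braids and their closures\<close>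

datatype braid_letter = Sigma nat | Sigma_inv nat

text \<open>
  Elements of the braid group on \<open>n\<close> strands are represented by words in the standard generators
  and their inverses.
\<close>

definition braid_words :: "nat \<Rightarrow> braid_letter list set"
  where "braid_words n = lists (Sigma ` {1..<n} \<union> Sigma_inv ` {1..<n})"

fun letter_exponent :: "braid_letter \<Rightarrow> int" where
  "letter_exponent (Sigma i) = 1"
| "letter_exponent (Sigma_inv i) = -1"

definition exponent_sum :: "braid_letter list \<Rightarrow> int"
  where "exponent_sum \<alpha> = sum_list (map letter_exponent \<alpha>)"

fun yh_letter :: "nat \<Rightarrow> complex \<Rightarrow> nat \<Rightarrow> braid_letter \<Rightarrow> yh_gen free_alg set" where
  "yh_letter d q n (Sigma i) = yh_class d q n (yh_g i)"
| "yh_letter d q n (Sigma_inv i) = inv\<^bsub>yh d q n\<^esub> (yh_class d q n (yh_g i))"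

definition yh_braid :: "nat \<Rightarrow> complex \<Rightarrow> nat \<Rightarrow> braid_letter list \<Rightarrow> yh_gen free_alg set"
  where "yh_braid d q n \<alpha> =
    foldr (\<lambda>l x. yh_letter d q n l \<otimes>\<^bsub>yh d q n\<^esub> x) \<alpha> \<one>\<^bsub>yh d q n\<^esub>"

text \<open>
  \<open>strand l j u\<close> is the position at time \<open>u \<in> [0, 1]\<close> of the strand that starts at the point \<open>(j, 0)\<close>,
  while the generator \<open>l\<close> is performed: the strands \<open>i\<close> and \<open>i + 1\<close> change places, and the sign of
  the second coordinate says which of them is in front. \<open>None\<close> stands for the trivial braid.
\<close>

fun strand :: "braid_letter option \<Rightarrow> nat \<Rightarrow> real \<Rightarrow> real \<times> real" where
  "strand None j u = (real j, 0)"
| "strand (Some (Sigma i)) j u =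
     (if j = i then (real i + u, u * (1 - u))
      else if j = i + 1 then (real i + 1 - u, - (u * (1 - u)))
      else (real j, 0))"
| "strand (Some (Sigma_inv i)) j u =
     (if j = i then (real i + u, - (u * (1 - u)))
      else if j = i + 1 then (real i + 1 - u, u * (1 - u))
      else (real j, 0))"

text \<open>
  The closure of a braid word as a subset of three-space: the braid runs once around the third
  coordinate axis, the cross-section at angle \<open>\<theta>\<close> lying in the half-plane at that angle, with
  \<open>fst p\<close> as the distance from the axis and \<open>snd p\<close> as the height. The first \<open>length \<alpha>\<close> of
  \<open>length \<alpha> + 1\<close> equal sectors perform the letters of \<open>\<alpha>\<close>, the last one contains the closing
  arcs. Strands are oriented by increasing angle; \<open>Sigma i\<close> is then a positive crossing.
\<close>

definition wrap :: "real \<Rightarrow> real \<times> real \<Rightarrow> real \<times> real \<times> real"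
  where "wrap \<theta> p = (fst p * cos \<theta>, fst p * sin \<theta>, snd p)"

definition braid_closure :: "nat \<Rightarrow> braid_letter list \<Rightarrow> (real \<times> real \<times> real) set"
  where "braid_closure n \<alpha> =
    {wrap (2 * pi * (real k + u) / real (length \<alpha> + 1))
        (strand (if k < length \<alpha> then Some (\<alpha> ! k) else None) j u) | k j u.
      k \<le> length \<alpha> \<and> j \<in> {1..n} \<and> u \<in> {0..1}}"

definition is_knot :: "(real \<times> real \<times> real) set \<Rightarrow> bool"
  where "is_knot L \<longleftrightarrow> card (components L) = 1"


section \<open>The invariants\<close>

text \<open>
  The invariants take their values in an algebraic closure of the field of rational functions in
  the indeterminate \<open>z\<close>, where the square roots live.
\<close>

type_synonym zfield = "complex poly fract alg_closure"

definition zconst :: "complex \<Rightarrow> zfield"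
  where "zconst c = to_ac (to_fract [:c:])"

definition zvar :: zfield
  where "zvar = to_ac (to_fract [:0, 1:])"

text \<open>
  The argument \<open>w\<close> of the following functions is the element substituted for \<open>z\<close>.
\<close>

definition lambda :: "nat set \<Rightarrow> complex \<Rightarrow> zfield \<Rightarrow> zfield"
  where "lambda D q w = (w - zconst ((q - inverse q) * (1 / of_nat (card D)))) / w"

text \<open>
  \<open>tr\<close> is the specialized trace for \<open>d\<close> and \<open>D\<close>, and \<open>s\<close> is the chosen square root of
  \<open>lambda D q w\<close>. The value is the one at the closure of the \<open>n\<close>-strand braid \<open>\<alpha>\<close>.
\<close>

definition Theta ::
    "nat \<Rightarrow> complex \<Rightarrow> (nat \<Rightarrow> yh_gen free_alg set \<Rightarrow> complex poly) \<Rightarrow> zfield \<Rightarrow> zfield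
     \<Rightarrow> nat \<Rightarrow> braid_letter list \<Rightarrow> zfield"
  where "Theta d q tr w s n \<alpha> =
    (1 / (w * s)) ^ (n - 1) * s powi exponent_sum \<alpha>
      * poly (map_poly zconst (tr n (yh_braid d q n \<alpha>))) w"

definition Homflypt ::
    "complex \<Rightarrow> (nat \<Rightarrow> yh_gen free_alg set \<Rightarrow> complex poly) \<Rightarrow> zfield \<Rightarrow> zfield
     \<Rightarrow> nat \<Rightarrow> braid_letter list \<Rightarrow> zfield"
  where "Homflypt q tr w s n \<alpha> = Theta 1 q tr w s n \<alpha>"

text \<open>
  Substituting \<open>z * card D\<close> for \<open>z\<close> turns \<open>lambda {0}\<close> into \<open>lambda D\<close>, so a square root of the
  latter serves for both invariants.
\<close>

lemma lambda_subst:
  assumes "finite D" and "D \<noteq> {}"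
  shows "lambda {0} q (w * of_nat (card D)) = lambda D q w"
proof -
  have pos: "card D > 0"
    using assms by (simp add: card_gt_0_iff)
  have ne: "(of_nat (card D) :: zfield) = zconst (of_nat (card D))"
  proof -
    have "(of_nat k :: zfield) = zconst (of_nat k)" for k
      by (induction k) (simp_all add: zconst_def one_pCons flip: to_ac_add to_fract_add,
          simp_all flip: to_ac_1 to_fract_1 to_ac_add to_fract_add add: one_pCons)
    then show ?thesis .
  qed
  have nz: "zconst (of_nat (card D)) \<noteq> 0"
    using pos by (simp add: zconst_def)
  have "zconst (q - inverse q)
      = zconst ((q - inverse q) * (1 / of_nat (card D))) * zconst (of_nat (card D))"
    using pos by (simp add: zconst_def flip: to_ac_mult to_fract_mult)
  then show ?thesis
    using nz by (simp add: lambda_def ne divide_simps algebra_simps)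
qed

end

theory Submission
  imports Defs
begin

text \<open>
  For a root of unity \<open>r\<close> of order dividing \<open>d\<close> let \<open>P\<^sub>r(t\<^sub>j)\<close> be the spectral projection of the
  framing generator \<open>t\<^sub>j\<close> to the eigenvalue \<open>r\<close>. These projections add up to one over all \<open>r\<close>, so the
  trace of a braid \<open>\<alpha>\<close> is the sum of the traces of \<open>P\<^sub>r(t\<^sub>1) \<alpha>\<close>. Moving \<open>P\<^sub>r(t\<^sub>j)\<close> to the right through
  \<open>\<alpha>\<close> turns \<open>j\<close> into its image under the permutation of \<open>\<alpha>\<close>, and cyclicity of the trace brings the
  result back to the left. As projections are idempotent, the original factor may be kept, and so
  one may insert \<open>P\<^sub>r(t\<^sub>j)\<close> for every \<open>j\<close> in the orbit of \<open>1\<close>. If the closure of \<open>\<alpha>\<close> is a knot, this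
  orbit consists of all strands (\<open>knot_imp_single_orbit\<close>), and the trace of \<open>\<alpha>\<close> is the sum over \<open>r\<close>
  of the traces of \<open>Q\<^sub>r \<alpha>\<close>, where \<open>Q\<^sub>r\<close> is the product of all \<open>P\<^sub>r(t\<^sub>j)\<close>
  (\<open>trace_knot_eq_sum_blocks\<close>). For links with several components mixed products of projections
  survive; this is where the hypothesis on knots enters.

  Next to \<open>Q\<^sub>r\<close> every \<open>e\<^sub>i\<close> acts as the identity, so the quadratic relation becomes that of the
  Iwahori--Hecke algebra, and \<open>a \<mapsto> tr (Q\<^sub>r a)\<close> behaves like a Markov trace on it
  (\<open>block_trace_ocneanu\<close>): a new strand contributes the trace of \<open>P\<^sub>r(t\<^sub>n\<^sub>+\<^sub>1)\<close>, which by
  orthogonality of characters is \<open>1/|D|\<close> or \<open>0\<close> according to whether the exponent \<open>k\<close> of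
  \<open>r = exp (2 \<pi> \<i> k / d)\<close> belongs to \<open>D\<close> (\<open>weight_unity_root\<close>), and the generator \<open>g\<^sub>n\<close> contributes \<open>z\<close>. Multiplied by \<open>|D|\<^sup>n\<close>, the
  functionals with \<open>k\<close> in \<open>D\<close> become Ocneanu traces with parameter \<open>z |D|\<close>.

  Such a trace is unique, because every word in the generators is a combination of words with at
  most one occurrence of the highest generator (\<open>hecke_functional_eq_zero\<close>). The trace for \<open>d = 1\<close>, evaluated
  at \<open>z |D|\<close>, is another one, since for \<open>d = 1\<close> there is only the block \<open>r = 1\<close>. Hence each of the
  \<open>|D|\<close> blocks contributes \<open>|D|\<^sup>-\<^sup>n\<close> times the value of that trace (\<open>knot_trace_pcompose\<close>), and the
  total factor \<open>|D|\<^sup>1\<^sup>-\<^sup>n\<close> is precisely the quotient of the two normalising powers in the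
  definition of the invariants.
\<close>


section \<open>Functionals on words with Hecke relations\<close>

text \<open>
  These are the functions that a linear functional on the Iwahori--Hecke algebra induces on words in
  its generators. Working with values on words makes it possible to speak about such functionals,
  and to prove that they agree, without constructing the algebra or a basis of it.
\<close>

definition hecke_functional :: "'a::comm_ring_1 \<Rightarrow> nat \<Rightarrow> (nat list \<Rightarrow> 'a) \<Rightarrow> bool"
  where "hecke_functional c n \<phi> \<longleftrightarrow>
    (\<forall>u\<in>lists {1..<n}. \<forall>v\<in>lists {1..<n}.
      (\<forall>i\<in>{1..<n}. \<phi> (u @ [i, i] @ v) = \<phi> (u @ v) + c * \<phi> (u @ [i] @ v)) \<and>
      (\<forall>i. 1 \<le> i \<and> Suc i < n \<longrightarrow> \<phi> (u @ [Suc i, i, Suc i] @ v) = \<phi> (u @ [i, Suc i, i] @ v)) \<and>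
      (\<forall>i j. 1 \<le> i \<and> Suc i < j \<and> j < n \<longrightarrow> \<phi> (u @ [j, i] @ v) = \<phi> (u @ [i, j] @ v)))"

lemma
  assumes "hecke_functional c n \<phi>" "u \<in> lists {1..<n}" "v \<in> lists {1..<n}"
  shows hecke_functional_quadratic:
      "1 \<le> i \<Longrightarrow> i < n \<Longrightarrow> \<phi> (u @ [i, i] @ v) = \<phi> (u @ v) + c * \<phi> (u @ [i] @ v)"
    and hecke_functional_braid:
      "1 \<le> i \<Longrightarrow> Suc i < n \<Longrightarrow> \<phi> (u @ [Suc i, i, Suc i] @ v) = \<phi> (u @ [i, Suc i, i] @ v)"
    and hecke_functional_far:
      "1 \<le> i \<Longrightarrow> Suc i < j \<Longrightarrow> j < n \<Longrightarrow> \<phi> (u @ [j, i] @ v) = \<phi> (u @ [i, j] @ v)"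
  using assms unfolding hecke_functional_def by auto

lemma hecke_functional_far_word:
  assumes "hecke_functional c n \<phi>" "Suc m < n" "w \<in> lists {1..<m}"
    "u \<in> lists {1..<n}" "v \<in> lists {1..<n}"
  shows "\<phi> (u @ [Suc m] @ w @ v) = \<phi> (u @ w @ [Suc m] @ v)"
  using assms(3,4)
proof (induction w arbitrary: u rule: list.induct)
  case (Cons i w)
  have w: "w \<in> lists {1..<n}"
    using Cons.prems assms(2) by auto
  have "\<phi> (u @ [Suc m, i] @ (w @ v)) = \<phi> (u @ [i, Suc m] @ (w @ v))"
    using Cons.prems assms w by (intro hecke_functional_far[OF assms(1)]) auto
  also have "\<dots> = \<phi> ((u @ [i]) @ w @ [Suc m] @ v)"
    using Cons.IH[of "u @ [i]"] Cons.prems assms(2) by auto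
  finally show ?case by simp
qed simp

lemma split_two_occurrences:
  assumes "count_list w x \<ge> 2"
  obtains u v u' where "w = u @ [x] @ v @ [x] @ u'" "x \<notin> set v"
proof -
  have "x \<in> set w"
    using assms by (metis count_list_0_iff not_numeral_le_zero)
  then obtain u w' where w: "w = u @ x # w'" "x \<notin> set u"
    by (meson split_list_first)
  have "x \<in> set w'"
  proof (rule ccontr)
    assume "x \<notin> set w'"
    with w assms show False by (simp add: count_notin)
  qed
  then obtain v u' where "w' = v @ x # u'" "x \<notin> set v"
    by (meson split_list_first)
  with w that show thesis by simp
qed

text \<open>
  The classical reduction behind \<open>H\<^sub>n\<^sub>+\<^sub>1 = H\<^sub>n + H\<^sub>n g\<^sub>n H\<^sub>n\<close>, phrased dually. Between two consecutive
  occurrences of the highest generator \<open>g\<^sub>m\<^sub>+\<^sub>1\<close> there is a word \<open>v\<close> in lower ones. As a function of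
  \<open>v\<close> the value is again such a functional, so by induction only the \<open>v\<close> with at most one \<open>g\<^sub>m\<close> need
  to be treated. If there is none, the two highest generators meet and the quadratic relation merges
  them; if there is one, the braid relation trades two of them for one.
\<close>

lemma hecke_functional_eq_zero:
  assumes "hecke_functional c (Suc n) \<phi>"
    and "\<And>w. w \<in> lists {1..<Suc n} \<Longrightarrow> count_list w n \<le> 1 \<Longrightarrow> \<phi> w = 0"
    and "w \<in> lists {1..<Suc n}"
  shows "\<phi> w = 0"
  using assms
proof (induction n arbitrary: \<phi> w)
  case 0
  from "0.prems"(3) have "w = []" by auto
  with 0 show ?case by simp
next
  case (Suc m)
  note H = Suc.prems(1) and low = Suc.prems(2)
  from Suc.prems(3) show ?case
  proof (induction "count_list w (Suc m)" arbitrary: w rule: less_induct)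
    case (less w)
    show ?case
    proof (cases "count_list w (Suc m) \<le> 1")
      case True
      then show ?thesis using low less.prems by blast
    next
      case False
      then obtain u v u' where w: "w = u @ [Suc m] @ v @ [Suc m] @ u'" and v: "Suc m \<notin> set v"
        using split_two_occurrences[of w "Suc m"] by (metis not_less_eq_eq numeral_2_eq_2 One_nat_def)
      have u: "u \<in> lists {1..<Suc (Suc m)}" "u' \<in> lists {1..<Suc (Suc m)}"
        using less.prems w by auto
      have vl: "v \<in> lists {1..<Suc m}"
        using less.prems w v by (auto simp: less_Suc_eq)
      define \<phi>' where "\<phi>' x = \<phi> (u @ [Suc m] @ x @ [Suc m] @ u')" for x
      have "hecke_functional c (Suc m) \<phi>'"
        unfolding hecke_functional_def
      proof (intro ballI conjI allI impI)
        fix a b assume ab: "a \<in> lists {1..<Suc m}" "b \<in> lists {1..<Suc m}"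
        let ?a = "u @ [Suc m] @ a" and ?b = "b @ [Suc m] @ u'"
        have c: "?a \<in> lists {1..<Suc (Suc m)}" "?b \<in> lists {1..<Suc (Suc m)}"
          using ab u by auto
        note H = H c
        show "\<phi>' (a @ [i, i] @ b) = \<phi>' (a @ b) + c * \<phi>' (a @ [i] @ b)" if "i \<in> {1..<Suc m}" for i
          using hecke_functional_quadratic[OF H, of i] that by (simp add: \<phi>'_def)
        show "\<phi>' (a @ [Suc i, i, Suc i] @ b) = \<phi>' (a @ [i, Suc i, i] @ b)"
          if "1 \<le> i \<and> Suc i < Suc m" for i
          using hecke_functional_braid[OF H, of i] that by (simp add: \<phi>'_def)
        show "\<phi>' (a @ [j, i] @ b) = \<phi>' (a @ [i, j] @ b)" if "1 \<le> i \<and> Suc i < j \<and> j < Suc m" for i j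
          using hecke_functional_far[OF H, of i j] that by (simp add: \<phi>'_def)
      qed
      moreover have "\<phi>' x = 0" if x: "x \<in> lists {1..<Suc m}" and cx: "count_list x m \<le> 1" for x
      proof -
        have top: "count_list x (Suc m) = 0"
          using x by (force simp: count_list_0_iff)
        have shorter: "\<phi> y = 0"
          if "y \<in> lists {1..<Suc (Suc m)}"
            "count_list y (Suc m) \<le> Suc (count_list u (Suc m) + count_list u' (Suc m))" for y
          using less.hyps[of y] that by (simp add: w)
        have mono: "z \<in> lists {1..<Suc (Suc m)}" if "z \<in> lists {1..<m}" for z
          using that by auto
        show ?thesis
        proof (cases "m \<in> set x")
          case False
          then have xm: "x \<in> lists {1..<m}"
            using x by (auto simp: less_Suc_eq)
          have "\<phi>' x = \<phi> ((u @ x) @ [Suc m, Suc m] @ u')"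
            using hecke_functional_far_word[OF H _ xm u(1), of "[Suc m] @ u'"] u
            by (simp add: \<phi>'_def)
          also have "\<dots> = \<phi> ((u @ x) @ u') + c * \<phi> ((u @ x) @ [Suc m] @ u')"
            using u mono[OF xm] by (intro hecke_functional_quadratic[OF H]) auto
          also have "\<dots> = 0"
            using u mono[OF xm] top by (simp add: shorter)
          finally show ?thesis .
        next
          case True
          then obtain a b where ab: "x = a @ m # b" "m \<notin> set a"
            by (meson split_list_first)
          then have "m \<notin> set b"
            using cx by (simp add: count_list_0_iff)
          then have abl: "a \<in> lists {1..<m}" "b \<in> lists {1..<m}"
            using x ab by (auto simp: less_Suc_eq)
          have m: "1 \<le> m"
            using x True by auto
          have "\<phi>' x = \<phi> (u @ a @ [Suc m] @ ([m] @ b @ [Suc m] @ u'))"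
            using hecke_functional_far_word[OF H _ abl(1) u(1), of "[m] @ b @ [Suc m] @ u'"] u
              mono[OF abl(2)] m
            by (simp add: \<phi>'_def ab)
          also have "\<dots> = \<phi> ((u @ a) @ [Suc m, m, Suc m] @ (b @ u'))"
            using hecke_functional_far_word[OF H _ abl(2) _ u(2), of "u @ a @ [Suc m, m]"] u
              mono[OF abl(1)] m
            by simp
          also have "\<dots> = \<phi> ((u @ a) @ [m, Suc m, m] @ (b @ u'))"
            using u mono[OF abl(1)] mono[OF abl(2)] m
            by (intro hecke_functional_braid[OF H]) auto
          also have "\<dots> = 0"
            using u mono[OF abl(1)] mono[OF abl(2)] m top
            by (intro shorter) (auto simp: ab)
          finally show ?thesis .
        qed
      qed
      ultimately have "\<phi>' v = 0"
        using vl by (rule Suc.IH)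
      then show ?thesis
        by (simp add: \<phi>'_def w)
    qed
  qed
qed

text \<open>
  The properties of an Ocneanu trace with Markov parameter \<open>\<zeta>\<close>, except that adding an unlinked
  strand multiplies the value by \<open>\<kappa>\<close>. The additional \<open>\<kappa>\<close> accommodates the functionals that the
  Yokonuma--Hecke trace induces on its blocks before they are normalised. The clause on inverse
  letters is the quadratic relation solved for the inverse.
\<close>

definition ocneanu_family ::
    "'a::comm_ring_1 \<Rightarrow> 'a \<Rightarrow> 'a \<Rightarrow> (nat \<Rightarrow> braid_letter list \<Rightarrow> 'a) \<Rightarrow> bool"
  where "ocneanu_family c \<kappa> \<zeta> f \<longleftrightarrow>
    (\<forall>n\<ge>1. hecke_functional c n (\<lambda>w. f n (map Sigma w)) \<and>
      (\<forall>u\<in>braid_words n. \<forall>v\<in>braid_words n. f n (u @ v) = f n (v @ u)) \<and>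
      (\<forall>u\<in>braid_words n. \<forall>v\<in>braid_words n. \<forall>i\<in>{1..<n}.
         f n (u @ [Sigma_inv i] @ v) = f n (u @ [Sigma i] @ v) - c * f n (u @ v)) \<and>
      (\<forall>w\<in>braid_words n. f (Suc n) w = \<kappa> * f n w) \<and>
      (\<forall>w\<in>braid_words n. f (Suc n) (w @ [Sigma n]) = \<zeta> * f n w))"

lemma hecke_functional_diff:
  assumes "hecke_functional c n \<phi>" "hecke_functional c n \<psi>"
  shows "hecke_functional c n (\<lambda>w. \<phi> w - \<psi> w)"
  using assms unfolding hecke_functional_def by (simp add: algebra_simps)

lemma map_Sigma_braid_words [simp]:
  "map Sigma w \<in> braid_words n \<longleftrightarrow> w \<in> lists {1..<n}"
  by (auto simp: braid_words_def)

text \<open>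
  By the reduction lemma only words with at most one highest generator matter, and on those the two
  Markov rules, after a cyclic rotation, lead to fewer strands.
\<close>

lemma ocneanu_family_unique_positive:
  assumes f: "ocneanu_family c \<kappa> \<zeta> f" and g: "ocneanu_family c \<kappa> \<zeta> g"
    and init: "f 1 [] = g 1 []"
    and "n \<ge> 1" "w \<in> lists {1..<n}"
  shows "f n (map Sigma w) = g n (map Sigma w)"
  using assms(4,5)
proof (induction n arbitrary: w rule: nat_induct_at_least)
  case base
  then show ?case using init by simp
next
  case (Suc n)
  let ?\<delta> = "\<lambda>w. f (Suc n) (map Sigma w) - g (Suc n) (map Sigma w)"
  have "?\<delta> w = 0"
  proof (rule hecke_functional_eq_zero)
    show "hecke_functional c (Suc n) ?\<delta>"
      using f g by (intro hecke_functional_diff) (auto simp: ocneanu_family_def)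
    show "w \<in> lists {1..<Suc n}" by fact
    fix x assume x: "x \<in> lists {1..<Suc n}" and cx: "count_list x n \<le> 1"
    show "?\<delta> x = 0"
    proof (cases "n \<in> set x")
      case False
      then have "x \<in> lists {1..<n}"
        using x by (auto simp: less_Suc_eq)
      then show ?thesis
        using f g Suc.hyps Suc.IH[of x] by (simp add: ocneanu_family_def)
    next
      case True
      then obtain a b where ab: "x = a @ n # b" "n \<notin> set a"
        by (meson split_list_first)
      then have "n \<notin> set b"
        using cx by (simp add: count_list_0_iff)
      then have abl: "a \<in> lists {1..<n}" "b \<in> lists {1..<n}"
        using x ab by (auto simp: less_Suc_eq)
      have val: "h (Suc n) (map Sigma x) = \<zeta> * h n (map Sigma (b @ a))"
        if h: "ocneanu_family c \<kappa> \<zeta> h" for h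
      proof -
        have "h (Suc n) (map Sigma (a @ [n]) @ map Sigma b)
            = h (Suc n) (map Sigma b @ map Sigma (a @ [n]))"
          using h abl Suc.hyps unfolding ocneanu_family_def
          by (metis (no_types, lifting) map_Sigma_braid_words x ab(1) append_Cons append_Nil append_assoc
              append_in_lists_conv le_SucI)
        also have "\<dots> = h (Suc n) (map Sigma (b @ a) @ [Sigma n])" by simp
        also have "\<dots> = \<zeta> * h n (map Sigma (b @ a))"
          using h abl Suc.hyps unfolding ocneanu_family_def
          by (metis map_Sigma_braid_words append_in_lists_conv)
        finally show ?thesis by (simp add: ab)
      qed
      show ?thesis
        using val[OF f] val[OF g] Suc.IH[of "b @ a"] abl by simp
    qed
  qed
  then show ?case by simp
qed

lemma ocneanu_family_unique:
  assumes f: "ocneanu_family c \<kappa> \<zeta> f" and g: "ocneanu_family c \<kappa> \<zeta> g"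
    and init: "f 1 [] = g 1 []" and n: "n \<ge> 1" and \<alpha>: "\<alpha> \<in> braid_words n"
  shows "f n \<alpha> = g n \<alpha>"
proof -
  \<comment> \<open>The prefix \<open>w\<close> collects the letters from which inverses have already been removed.\<close>
  have "f n (map Sigma w @ \<alpha>) = g n (map Sigma w @ \<alpha>)" if "w \<in> lists {1..<n}" for w
    using \<alpha> that
  proof (induction \<alpha> arbitrary: w)
    case Nil
    then show ?case
      using ocneanu_family_unique_positive[OF f g init n] by simp
  next
    case (Cons l \<alpha>)
    have \<alpha>: "\<alpha> \<in> braid_words n"
      using Cons.prems by (simp add: braid_words_def)
    from Cons.prems consider i where "l = Sigma i" "i \<in> {1..<n}" | i where "l = Sigma_inv i" "i \<in> {1..<n}"
      by (auto simp: braid_words_def)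
    then show ?case
    proof cases
      case 1
      then show ?thesis
        using Cons.IH[OF \<alpha>, of "w @ [i]"] Cons.prems by simp
    next
      case 2
      have inv: "h n (map Sigma w @ [Sigma_inv i] @ \<alpha>)
          = h n (map Sigma (w @ [i]) @ \<alpha>) - c * h n (map Sigma w @ \<alpha>)"
        if "ocneanu_family c \<kappa> \<zeta> h" for h
        using that n \<alpha> 2 Cons.prems unfolding ocneanu_family_def by simp
      show ?thesis
        using inv[OF f] inv[OF g] Cons.IH[OF \<alpha>, of "w @ [i]"] Cons.IH[OF \<alpha>, of w] Cons.prems 2
        by simp
    qed
  qed
  from this[of "[]"] show ?thesis by simp
qed

lemma hecke_functional_scale:
  assumes "hecke_functional c n \<phi>"
  shows "hecke_functional c n (\<lambda>w. k * \<phi> w)"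
  using assms unfolding hecke_functional_def by (simp add: algebra_simps)

lemma ocneanu_familyI:
  assumes "\<And>n. n \<ge> 1 \<Longrightarrow> hecke_functional c n (\<lambda>w. f n (map Sigma w))"
    and "\<And>n u v. n \<ge> 1 \<Longrightarrow> u \<in> braid_words n \<Longrightarrow> v \<in> braid_words n \<Longrightarrow> f n (u @ v) = f n (v @ u)"
    and "\<And>n u v i. n \<ge> 1 \<Longrightarrow> u \<in> braid_words n \<Longrightarrow> v \<in> braid_words n \<Longrightarrow> 1 \<le> i \<Longrightarrow> i < n \<Longrightarrow>
       f n (u @ [Sigma_inv i] @ v) = f n (u @ [Sigma i] @ v) - c * f n (u @ v)"
    and "\<And>n w. n \<ge> 1 \<Longrightarrow> w \<in> braid_words n \<Longrightarrow> f (Suc n) w = \<kappa> * f n w"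
    and "\<And>n w. n \<ge> 1 \<Longrightarrow> w \<in> braid_words n \<Longrightarrow> f (Suc n) (w @ [Sigma n]) = \<zeta> * f n w"
  shows "ocneanu_family c \<kappa> \<zeta> f"
  unfolding ocneanu_family_def using assms by simp

text \<open>
  The factor \<open>k ^ n\<close> depends on the number of strands, which is why it shows up in both Markov
  parameters; this is how \<open>1/|D|\<close> is normalised to \<open>1\<close> at the price of turning \<open>z\<close> into \<open>z |D|\<close>.
\<close>

lemma ocneanu_family_scale:
  assumes "ocneanu_family c \<kappa> \<zeta> f"
  shows "ocneanu_family c (k * \<kappa>) (k * \<zeta>) (\<lambda>n w. k ^ n * f n w)"
  using assms
  by (intro ocneanu_familyI hecke_functional_scale)
    (simp_all add: ocneanu_family_def right_diff_distrib mult.left_commute mult.assoc)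

lemma hecke_functional_pcompose:
  assumes "hecke_functional [:c:] n \<phi>"
  shows "hecke_functional [:c:] n (\<lambda>w. pcompose (\<phi> w) p)"
  using assms unfolding hecke_functional_def by (simp add: pcompose_add pcompose_smult)

lemma ocneanu_family_pcompose:
  assumes "ocneanu_family [:c:] [:\<kappa>:] \<zeta> f"
  shows "ocneanu_family [:c:] [:\<kappa>:] (pcompose \<zeta> p) (\<lambda>n w. pcompose (f n w) p)"
  using assms
  by (intro ocneanu_familyI hecke_functional_pcompose)
    (simp_all add: ocneanu_family_def pcompose_mult pcompose_diff pcompose_smult)

section \<open>The permutation of a braid and the components of its closure\<close>

fun letter_perm :: "braid_letter \<Rightarrow> nat \<Rightarrow> nat" where
  "letter_perm (Sigma i) = Transposition.transpose i (i + 1)"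
| "letter_perm (Sigma_inv i) = Transposition.transpose i (i + 1)"

definition braid_perm :: "braid_letter list \<Rightarrow> nat \<Rightarrow> nat"
  where "braid_perm \<alpha> = fold letter_perm \<alpha>"

lemma braid_perm_simps [simp]:
  "braid_perm [] = id"
  "braid_perm (l # \<alpha>) = braid_perm \<alpha> \<circ> letter_perm l"
  by (simp_all add: braid_perm_def)

lemma bij_braid_perm: "bij (braid_perm \<alpha>)"
proof (induction \<alpha>)
  case (Cons l \<alpha>)
  have "bij (letter_perm l)" by (cases l) simp_all
  with Cons show ?case by (simp only: braid_perm_simps bij_comp)
qed (simp only: braid_perm_simps bij_id)

lemma letter_perm_image:
  assumes "[l] \<in> braid_words n"
  shows "letter_perm l ` {1..n} = {1..n}"
proof -
  have "finite {1..n}" "letter_perm l ` {1..n} \<subseteq> {1..n}"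
    using assms by (auto simp: braid_words_def Transposition.transpose_def)
  moreover have "inj_on (letter_perm l) {1..n}"
    using bij_braid_perm[of "[l]"] by (auto simp: bij_def intro: inj_on_subset)
  ultimately show ?thesis by (rule endo_inj_surj)
qed

lemma braid_perm_image:
  assumes "\<alpha> \<in> braid_words n"
  shows "braid_perm \<alpha> ` {1..n} = {1..n}"
  using assms
proof (induction \<alpha>)
  case (Cons l \<alpha>)
  then have "[l] \<in> braid_words n" "\<alpha> \<in> braid_words n"
    by (auto simp: braid_words_def)
  then show ?case
    using letter_perm_image[of l n] Cons.IH by (simp only: braid_perm_simps image_comp[symmetric])
qed simp

text \<open>
  Two crossing strands have the same first coordinate only at time \<open>1/2\<close>, where their heights
  differ; every other strand stays at an integer that the crossing strands do not reach.
\<close>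

lemma strand_inj:
  assumes "strand l j u = strand l j' u" "0 \<le> u" "u < 1"
  shows "j = j'"
proof -
  have crossing: "strand l i u \<noteq> strand l (i + 1) u"
    if l: "l = Some (Sigma i) \<or> l = Some (Sigma_inv i)" for i
  proof
    assume eq: "strand l i u = strand l (i + 1) u"
    have "real i + u = real i + 1 - u" "u * (1 - u) = - (u * (1 - u))"
      using l arg_cong[OF eq, of fst] arg_cong[OF eq, of snd] by auto
    then have "u = 1 / 2" "u * (1 - u) = 0" by linarith+
    then show False by simp
  qed
  have away: "k = i \<or> k = i + 1"
    if l: "l = Some (Sigma i) \<or> l = Some (Sigma_inv i)"
      and eq: "strand l k u = strand l m u" and m: "m = i \<or> m = i + 1" for i k m
  proof (rule ccontr)
    assume n: "\<not> (k = i \<or> k = i + 1)"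
    have "fst (strand l k u) = real k"
      using l n by auto
    moreover have "fst (strand l m u) = real i + u \<or> fst (strand l m u) = real i + 1 - u"
      using l m by auto
    ultimately have "real i \<le> real k \<and> real k \<le> real (i + 1)"
      using arg_cong[OF eq, of fst] assms(2,3) by auto
    with n show False by linarith
  qed
  consider "l = None" | i where "l = Some (Sigma i) \<or> l = Some (Sigma_inv i)"
    by (metis braid_letter.exhaust option.exhaust)
  then show ?thesis
  proof cases
    case 1
    then show ?thesis using assms(1) by simp
  next
    case 2
    show ?thesis
    proof (cases "j = i \<or> j = i + 1 \<or> j' = i \<or> j' = i + 1")
      case True
      then have "j = i \<or> j = i + 1" "j' = i \<or> j' = i + 1"
        using away[OF 2 assms(1)] away[OF 2 assms(1)[symmetric]] by blast+
      then show ?thesis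
        using crossing[OF 2] assms(1) by metis
    next
      case False
      then show ?thesis
        using 2 assms(1) by auto
    qed
  qed
qed

lemma strand_end:
  "strand (Some l) j 1 = (real (letter_perm l j), 0)"
  by (cases l) (auto simp: Transposition.transpose_def)

lemma strand_start: "strand l j 0 = (real j, 0)"
proof (cases l)
  case (Some x)
  then show ?thesis by (cases x) auto
qed simp

lemma strand_off_axis:
  assumes "l = None \<or> (\<exists>x. l = Some x \<and> [x] \<in> braid_words n)" "j \<ge> 1" "0 \<le> u" "u \<le> 1"
  shows "fst (strand l j u) > 0"
proof (cases l)
  case (Some x)
  then show ?thesis
    using assms by (cases x) (auto simp: braid_words_def)
qed (use assms in simp)

lemma continuous_on_strand: "continuous_on A (\<lambda>u. strand l j u)"
proof -
  consider "l = None" | i where "l = Some (Sigma i)" | i where "l = Some (Sigma_inv i)"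
    by (metis braid_letter.exhaust option.exhaust)
  then show ?thesis
  proof cases
    case 2
    then show ?thesis
      by (cases "j = i"; cases "j = i + 1") (auto intro!: continuous_intros)
  next
    case 3
    then show ?thesis
      by (cases "j = i"; cases "j = i + 1") (auto intro!: continuous_intros)
  qed simp
qed

text \<open>Off the axis, cylindrical coordinates are unique.\<close>

lemma wrap_inj:
  assumes "wrap \<theta> p = wrap \<theta>' p'" "fst p > 0" "fst p' > 0"
    "0 \<le> \<theta>" "\<theta> < 2 * pi" "0 \<le> \<theta>'" "\<theta>' < 2 * pi"
  shows "\<theta> = \<theta>' \<and> p = p'"
proof -
  have c: "fst p * cos \<theta> = fst p' * cos \<theta>'" and s: "fst p * sin \<theta> = fst p' * sin \<theta>'"
    and z: "snd p = snd p'"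
    using assms(1) by (auto simp: wrap_def)
  have sq: "(r * cos t)\<^sup>2 + (r * sin t)\<^sup>2 = r\<^sup>2" for r t :: real
  proof -
    have "(r * cos t)\<^sup>2 + (r * sin t)\<^sup>2 = r\<^sup>2 * ((sin t)\<^sup>2 + (cos t)\<^sup>2)"
      by (simp only: power_mult_distrib distrib_left add.commute)
    then show ?thesis by (simp only: sin_cos_squared_add mult_1_right)
  qed
  have "(fst p)\<^sup>2 = (fst p')\<^sup>2"
    using sq[of "fst p" \<theta>] sq[of "fst p'" \<theta>'] unfolding c s by simp
  then have r: "fst p = fst p'"
    using assms(2,3) power2_eq_imp_eq by (metis less_imp_le)
  then have "sin \<theta> = sin \<theta>' \<and> cos \<theta> = cos \<theta>'"
    using c s assms(3) by simp
  then obtain m :: int where m: "\<theta> = \<theta>' + 2 * pi * m"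
    using sin_cos_eq_iff[of \<theta> \<theta>'] by blast
  have "pi * m < pi * 1" "pi * (-1) < pi * m"
    using m assms(4-7) by linarith+
  then have "real_of_int m < 1" "-1 < real_of_int m"
    using mult_less_cancel_left_pos[OF pi_gt_zero] by blast+
  then have "m = 0" by linarith
  with m r z show ?thesis by (simp add: prod_eq_iff)
qed

text \<open>
  The part of the closure that is met when one starts at the positions in \<open>S\<close> at angle zero and goes
  around the axis once: at the beginning of sector \<open>k\<close> these strands sit at the positions given by
  the permutation of the first \<open>k\<close> letters.
\<close>

definition traced_out :: "braid_letter list \<Rightarrow> nat set \<Rightarrow> (real \<times> real \<times> real) set"
  where "traced_out \<alpha> S = (\<Union>k\<in>{..length \<alpha>}. \<Union>j\<in>braid_perm (take k \<alpha>) ` S.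
    (\<lambda>u. wrap (2 * pi * (real k + u) / real (length \<alpha> + 1))
       (strand (if k < length \<alpha> then Some (\<alpha> ! k) else None) j u)) ` {0..1})"

lemma braid_words_take: "\<alpha> \<in> braid_words n \<Longrightarrow> take k \<alpha> \<in> braid_words n"
  by (auto simp: braid_words_def dest: in_set_takeD)

lemma braid_closure_eq_traced_out:
  assumes "\<alpha> \<in> braid_words n"
  shows "braid_closure n \<alpha> = traced_out \<alpha> {1..n}"
  unfolding traced_out_def braid_perm_image[OF braid_words_take[OF assms]] braid_closure_def
  by blast

lemma traced_out_Un: "traced_out \<alpha> (S \<union> S') = traced_out \<alpha> S \<union> traced_out \<alpha> S'"
  unfolding traced_out_def by blast

lemma traced_out_nonempty: "S \<noteq> {} \<Longrightarrow> traced_out \<alpha> S \<noteq> {}"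
  unfolding traced_out_def by auto

lemma closed_traced_out:
  assumes "finite S"
  shows "closed (traced_out \<alpha> S)"
proof -
  have "compact ((\<lambda>u. wrap (2 * pi * (real k + u) / real (length \<alpha> + 1)) (strand l j u)) ` {0..1})"
    for k l j
    unfolding wrap_def
    by (intro compact_continuous_image continuous_intros continuous_on_strand) auto
  then show ?thesis
    unfolding traced_out_def using assms
    by (intro compact_imp_closed compact_UN) auto
qed

text \<open>
  The end of a sector is the beginning of the next one, and, as \<open>S\<close> is invariant, the end of the
  last sector is the beginning of the first one. With \<open>u < 1\<close> the angle of a point determines its
  sector, so that boundary points need no case distinction later on.
\<close>

lemma traced_out_half_open:
  assumes "braid_perm \<alpha> ` S \<subseteq> S" "x \<in> traced_out \<alpha> S"
  obtains k j u where "k \<le> length \<alpha>" "j \<in> braid_perm (take k \<alpha>) ` S" "0 \<le> u" "u < 1"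
    "x = wrap (2 * pi * (real k + u) / real (length \<alpha> + 1))
       (strand (if k < length \<alpha> then Some (\<alpha> ! k) else None) j u)"
proof -
  let ?N = "real (length \<alpha> + 1)"
  obtain k j u where kju: "k \<le> length \<alpha>" "j \<in> braid_perm (take k \<alpha>) ` S" "0 \<le> u" "u \<le> 1"
    "x = wrap (2 * pi * (real k + u) / ?N)
       (strand (if k < length \<alpha> then Some (\<alpha> ! k) else None) j u)"
  proof -
    from assms(2) obtain k j where kj: "k \<le> length \<alpha>" "j \<in> braid_perm (take k \<alpha>) ` S"
      "x \<in> (\<lambda>u. wrap (2 * pi * (real k + u) / ?N)
         (strand (if k < length \<alpha> then Some (\<alpha> ! k) else None) j u)) ` {0..1}"
      unfolding traced_out_def by (elim UN_E) simp
    from kj(3) obtain u where "x = wrap (2 * pi * (real k + u) / ?N)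
         (strand (if k < length \<alpha> then Some (\<alpha> ! k) else None) j u)" "u \<in> {0..1}"
      by (rule imageE)
    then show thesis
      using that[OF kj(1,2), of u] by simp
  qed
  show thesis
  proof (cases "u < 1")
    case True
    with kju that show thesis by blast
  next
    case False
    then have u: "u = 1" using kju by simp
    show thesis
    proof (cases "k < length \<alpha>")
      case True
      have "letter_perm (\<alpha> ! k) j \<in> braid_perm (take (Suc k) \<alpha>) ` S"
        using kju(2) True by (auto simp: braid_perm_def take_Suc_conv_app_nth)
      moreover have "x = wrap (2 * pi * (real (Suc k) + 0) / ?N)
          (strand (if Suc k < length \<alpha> then Some (\<alpha> ! Suc k) else None) (letter_perm (\<alpha> ! k) j) 0)"
        using kju(5) u True by (simp only: strand_start strand_end if_True of_nat_Suc add_0_right add_0_left add.commute)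
      ultimately show thesis
        using that[of "Suc k" "letter_perm (\<alpha> ! k) j" 0] True by simp
    next
      case False
      then have k: "k = length \<alpha>" using kju by simp
      have "x = wrap (2 * pi * (real 0 + 0) / ?N)
          (strand (if 0 < length \<alpha> then Some (\<alpha> ! 0) else None) j 0)"
        using kju(5) u k by (simp add: strand_start wrap_def add.commute)
      moreover have "j \<in> S"
        using kju(2) k assms(1) by auto
      ultimately show thesis
        using that[of 0 j 0] by simp
    qed
  qed
qed

lemma traced_out_disjoint:
  assumes \<alpha>: "\<alpha> \<in> braid_words n"
    and S: "S \<subseteq> {1..n}" "braid_perm \<alpha> ` S \<subseteq> S"
    and S': "S' \<subseteq> {1..n}" "braid_perm \<alpha> ` S' \<subseteq> S'"
    and "S \<inter> S' = {}"
  shows "traced_out \<alpha> S \<inter> traced_out \<alpha> S' = {}"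
proof (rule ccontr)
  let ?N = "real (length \<alpha> + 1)"
  let ?l = "\<lambda>k. if k < length \<alpha> then Some (\<alpha> ! k) else None"
  assume "\<not> ?thesis"
  then obtain x where x: "x \<in> traced_out \<alpha> S" "x \<in> traced_out \<alpha> S'" by blast
  obtain k j u where 1: "k \<le> length \<alpha>" "j \<in> braid_perm (take k \<alpha>) ` S" "0 \<le> u" "u < 1"
    "x = wrap (2 * pi * (real k + u) / ?N) (strand (?l k) j u)"
    using traced_out_half_open[OF S(2) x(1)] by blast
  obtain k' j' u' where 2: "k' \<le> length \<alpha>" "j' \<in> braid_perm (take k' \<alpha>) ` S'" "0 \<le> u'" "u' < 1"
    "x = wrap (2 * pi * (real k' + u') / ?N) (strand (?l k') j' u')"
    using traced_out_half_open[OF S'(2) x(2)] by blast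
  have valid: "?l k = None \<or> (\<exists>x. ?l k = Some x \<and> [x] \<in> braid_words n)" for k
    using \<alpha> by (auto simp: braid_words_def)
  have pos: "j \<ge> 1" if "j \<in> braid_perm (take k \<alpha>) ` S" "S \<subseteq> {1..n}" for j k S
    using that braid_perm_image[OF braid_words_take[OF \<alpha>], of k] by (metis atLeastAtMost_iff image_mono subsetD)
  have angle: "0 \<le> 2 * pi * (real k + u) / ?N \<and> 2 * pi * (real k + u) / ?N < 2 * pi"
    if "k \<le> length \<alpha>" "0 \<le> u" "u < 1" for k u
  proof -
    have "(real k + u) / ?N < 1" using that by (simp add: divide_simps)
    then have "2 * pi * ((real k + u) / ?N) < 2 * pi * 1"
      by (intro mult_strict_left_mono) auto
    with that show ?thesis by simp
  qed
  have "2 * pi * (real k + u) / ?N = 2 * pi * (real k' + u') / ?N \<and>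
      strand (?l k) j u = strand (?l k') j' u'"
  proof (rule wrap_inj)
    show "wrap (2 * pi * (real k + u) / ?N) (strand (?l k) j u)
        = wrap (2 * pi * (real k' + u') / ?N) (strand (?l k') j' u')"
      using 1(5) 2(5) by (rule trans[OF sym])
    show "fst (strand (?l k) j u) > 0" "fst (strand (?l k') j' u') > 0"
      using strand_off_axis[OF valid pos[OF 1(2) S(1)], of u k]
        strand_off_axis[OF valid pos[OF 2(2) S'(1)], of u' k'] 1(3,4) 2(3,4) by linarith+
  qed (use angle[OF 1(1,3,4)] angle[OF 2(1,3,4)] in blast)+
  then have st: "strand (?l k) j u = strand (?l k') j' u'"
    and "2 * pi * (real k + u) / ?N = 2 * pi * (real k' + u') / ?N"
    by blast+
  then have "real k + u = real k' + u'"
    by simp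
  moreover from this have k: "k = k'"
    using 1(3,4) 2(3,4) by linarith
  ultimately have u: "u = u'" by simp
  have "j = j'"
    using strand_inj[OF _ 1(3,4)] st unfolding k u by blast
  then have "braid_perm (take k \<alpha>) ` S \<inter> braid_perm (take k \<alpha>) ` S' \<noteq> {}"
    using 1(2) 2(2) k \<open>j = j'\<close> by blast
  then show False
    using assms(6) image_Int[OF bij_is_inj[OF bij_braid_perm[of "take k \<alpha>"]], of S S'] by simp
qed

text \<open>
  An invariant set and its complement trace out two disjoint non-empty closed sets that cover the
  closure, which is impossible for a connected set.
\<close>

lemma knot_imp_transitive:
  assumes \<alpha>: "\<alpha> \<in> braid_words n" and knot: "is_knot (braid_closure n \<alpha>)"
    and S: "S \<subseteq> {1..n}" "S \<noteq> {}" "braid_perm \<alpha> ` S = S"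
  shows "S = {1..n}"
proof (rule ccontr)
  assume ne: "S \<noteq> {1..n}"
  define S' where "S' = {1..n} - S"
  have S': "S' \<subseteq> {1..n}" "S' \<noteq> {}" "S \<inter> S' = {}" "S \<union> S' = {1..n}"
    using ne S by (auto simp: S'_def)
  have "braid_perm \<alpha> ` S' = S'"
    unfolding S'_def
    by (simp only: image_set_diff[OF bij_is_inj[OF bij_braid_perm]] S(3) braid_perm_image[OF \<alpha>])
  then have disj: "traced_out \<alpha> S \<inter> traced_out \<alpha> S' = {}"
    using traced_out_disjoint[OF \<alpha> S(1) _ S'(1) _ S'(3)] S(3) by blast
  have closure: "braid_closure n \<alpha> = traced_out \<alpha> S \<union> traced_out \<alpha> S'"
    by (simp only: braid_closure_eq_traced_out[OF \<alpha>] S'(4) flip: traced_out_Un)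
  obtain C where C: "components (braid_closure n \<alpha>) = {C}"
    using knot unfolding is_knot_def by (rule card_1_singletonE)
  then have "braid_closure n \<alpha> = C"
    using Union_components[of "braid_closure n \<alpha>"] by simp
  then have "connected (braid_closure n \<alpha>)"
    using C in_components_connected by blast
  moreover have "closed (traced_out \<alpha> S)" "closed (traced_out \<alpha> S')"
    using finite_subset[OF S(1)] finite_subset[OF S'(1)] closed_traced_out by simp_all
  ultimately show False
    using connected_closedD[of "braid_closure n \<alpha>" "traced_out \<alpha> S" "traced_out \<alpha> S'"]
      disj traced_out_nonempty[OF S(2), of \<alpha>] traced_out_nonempty[OF S'(2), of \<alpha>]
    unfolding closure by blast
qed

text \<open>The orbit of strand \<open>1\<close> is invariant, and finitely many iterates exhaust it.\<close>

lemma knot_imp_single_orbit: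
  assumes \<alpha>: "\<alpha> \<in> braid_words n" and knot: "is_knot (braid_closure n \<alpha>)"
    and n: "n \<ge> 1"
  shows "\<exists>m. {1..n} = (\<lambda>i. (braid_perm \<alpha> ^^ i) 1) ` {..m}"
proof -
  let ?o = "\<lambda>i. (braid_perm \<alpha> ^^ i) 1"
  have step: "braid_perm \<alpha> x \<in> {1..n}" if "x \<in> {1..n}" for x
    using imageI[OF that, of "braid_perm \<alpha>"] by (simp only: braid_perm_image[OF \<alpha>])
  have "?o i \<in> {1..n}" for i
  proof (induction i)
    case (Suc i)
    then show ?case using step by (simp only: funpow.simps comp_apply)
  qed (use n in simp)
  then have sub: "range ?o \<subseteq> {1..n}" by blast
  have "braid_perm \<alpha> ` range ?o \<subseteq> range ?o"
  proof
    fix x assume "x \<in> braid_perm \<alpha> ` range ?o"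
    then obtain i where "x = ?o (Suc i)" by auto
    then show "x \<in> range ?o" by blast
  qed
  moreover have "inj_on (braid_perm \<alpha>) (range ?o)"
    using bij_braid_perm[of \<alpha>] bij_is_inj inj_on_subset by blast
  ultimately have "braid_perm \<alpha> ` range ?o = range ?o"
    using finite_subset[OF sub finite_atLeastAtMost] by (rule endo_inj_surj[rotated])
  then have range: "range ?o = {1..n}"
    by (rule knot_imp_transitive[OF \<alpha> knot sub, rotated]) blast
  have "{1..n} \<subseteq> range ?o" by (simp only: range)
  then have "\<exists>F\<subseteq>UNIV. finite F \<and> {1..n} = ?o ` F"
    by (rule finite_subset_image[OF finite_atLeastAtMost])
  then obtain F where F: "finite F" "{1..n} = ?o ` F"
    by (elim exE conjE)
  have "?o ` F \<subseteq> ?o ` {..Max F}"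
    using F(1) by (intro image_mono) auto
  moreover have "?o ` {..Max F} \<subseteq> range ?o" by blast
  ultimately have "{1..n} = ?o ` {..Max F}"
    unfolding F(2)[symmetric] range by (rule equalityI)
  then show ?thesis ..
qed

section \<open>Congruence of free algebra elements modulo the Yokonuma--Hecke relations\<close>

lemma free_alg_on_simps:
  "a \<otimes>\<^bsub>free_alg_on S\<^esub> b = a * b" "a \<oplus>\<^bsub>free_alg_on S\<^esub> b = a + b"
  "\<one>\<^bsub>free_alg_on S\<^esub> = 1" "\<zero>\<^bsub>free_alg_on S\<^esub> = 0"
  by (simp_all add: free_alg_on_def)

lemma yh_free_simps [simp]:
  "a \<otimes>\<^bsub>yh_free n\<^esub> b = a * b" "a \<oplus>\<^bsub>yh_free n\<^esub> b = a + b"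
  "\<one>\<^bsub>yh_free n\<^esub> = 1" "\<zero>\<^bsub>yh_free n\<^esub> = 0"
  by (simp_all add: yh_free_def free_alg_on_simps)

lemma ring_yh_free: "ring (yh_free n)"
  by (simp add: yh_free_def ring_free_alg_on)

abbreviation YF :: "nat \<Rightarrow> yh_gen free_alg set"
  where "YF n \<equiv> carrier (yh_free n)"

lemma fa_scalar_in_YF [simp]: "fa_scalar c \<in> YF n"
  by (simp add: yh_free_def free_alg_on_def fa_scalar_def zero_free_monoid_def)

lemma
  shows yh_g_in_YF [simp]: "1 \<le> i \<Longrightarrow> i < n \<Longrightarrow> yh_g i \<in> YF n"
    and yh_t_in_YF [simp]: "1 \<le> i \<Longrightarrow> i \<le> n \<Longrightarrow> yh_t i \<in> YF n"
  by (auto simp: yh_free_def free_alg_on_def fa_gen_def)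

lemma YF_mono: "a \<in> YF n \<Longrightarrow> a \<in> YF (Suc n)"
proof -
  have gens: "G ` {1..<n} \<union> T ` {1..n} \<subseteq> G ` {1..<Suc n} \<union> T ` {1..Suc n}"
    by auto
  assume "a \<in> YF n"
  then have "\<forall>w\<in>Poly_Mapping.keys a. set (letters w) \<subseteq> G ` {1..<n} \<union> T ` {1..n}"
    unfolding yh_free_def free_alg_on_def by simp
  then have "\<forall>w\<in>Poly_Mapping.keys a. set (letters w) \<subseteq> G ` {1..<Suc n} \<union> T ` {1..Suc n}"
    using order_trans[OF _ gens] by blast
  then show "a \<in> YF (Suc n)"
    unfolding yh_free_def free_alg_on_def by simp
qed

lemma
  assumes "a \<in> YF n" "b \<in> YF n"
  shows YF_add [simp]: "a + b \<in> YF n" and YF_mult [simp]: "a * b \<in> YF n"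
  using ring.ring_simprules(1,5)[OF ring_yh_free assms] by simp_all

lemma YF_0 [simp]: "0 \<in> YF n" and YF_1 [simp]: "1 \<in> YF n"
  using ring.ring_simprules(2,6)[OF ring_yh_free, of n] by simp_all

lemma YF_uminus [simp]: "a \<in> YF n \<Longrightarrow> - a \<in> YF n"
  by (simp add: yh_free_def free_alg_on_def)

lemma YF_diff [simp]: "a \<in> YF n \<Longrightarrow> b \<in> YF n \<Longrightarrow> a - b \<in> YF n"
  using YF_add[of a n "- b"] by simp

lemma YF_power [simp]: "a \<in> YF n \<Longrightarrow> a ^ k \<in> YF n"
  by (induction k) simp_all

lemma YF_sum [simp]: "(\<And>x. x \<in> A \<Longrightarrow> f x \<in> YF n) \<Longrightarrow> sum f A \<in> YF n"
  by (induction A rule: infinite_finite_induct) simp_all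

lemma yh_free_minus: "a \<in> YF n \<Longrightarrow> b \<in> YF n \<Longrightarrow> a \<ominus>\<^bsub>yh_free n\<^esub> b = a - b"
  using abelian_group.minus_equality[OF ring.is_abelian_group[OF ring_yh_free[of n]], of "- b" b]
  by (simp add: a_minus_def)

lemma fa_scalar_simps:
  "fa_scalar 1 = 1" "fa_scalar 0 = 0" "fa_scalar a * fa_scalar b = fa_scalar (a * b)"
  "fa_scalar a + fa_scalar b = fa_scalar (a + b)"
  by (simp_all add: fa_scalar_def mult_single single_add)

lemma fa_scalar_sum: "fa_scalar (sum f A) = (\<Sum>x\<in>A. fa_scalar (f x))"
  by (induction A rule: infinite_finite_induct) (simp_all add: fa_scalar_simps(2) flip: fa_scalar_simps(4))

lemma fa_scalar_commute: "fa_scalar c * a = a * fa_scalar c"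
proof (induction a rule: Poly_Mapping.update_induct)
  case (update f a b)
  have "Poly_Mapping.update a b f = f + Poly_Mapping.single a b"
    using update(1)
    by (intro poly_mapping_eqI)
      (auto simp: lookup_update lookup_add lookup_single when_def in_keys_iff)
  then show ?case
    using update(3) by (simp add: distrib_left distrib_right fa_scalar_def mult_single mult.commute)
qed simp

lemma fa_scalar_left_commute: "a * (fa_scalar c * b) = fa_scalar c * (a * b)"
  by (simp only: fa_scalar_commute[of c a, symmetric] mult.assoc[symmetric])

lemma fa_scalar_neg_one: "fa_scalar (-1) * a = - (a :: 'a free_alg)"
proof -
  have "fa_scalar (-1) = (- 1 :: 'a free_alg)"
    by (simp add: fa_scalar_def single_uminus)
  then show ?thesis by simp
qed

lemma yh_e_in_YF [simp]: "1 \<le> i \<Longrightarrow> i < n \<Longrightarrow> yh_e d i \<in> YF n"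
  by (simp add: yh_e_def)

lemma yh_rel_in_YF: "yh_rel d q n a b \<Longrightarrow> a \<in> YF n \<and> b \<in> YF n"
  by (induction rule: yh_rel.induct) (auto simp: Transposition.transpose_def)

lemma ideal_yh_ideal: "ideal (yh_ideal d q n) (yh_free n)"
  unfolding yh_ideal_def
  by (rule ring.genideal_ideal[OF ring_yh_free]) (auto dest: yh_rel_in_YF)

lemma ring_yh: "ring (yh d q n)"
  unfolding yh_def by (rule ideal.quotient_is_ring[OF ideal_yh_ideal])

lemma yh_class_hom: "yh_class d q n \<in> ring_hom (yh_free n) (yh d q n)"
  using ideal.rcos_ring_hom[OF ideal_yh_ideal] by (simp add: yh_class_def[abs_def] yh_def)

lemma
  assumes "a \<in> YF n" "b \<in> YF n"
  shows yh_class_mult: "yh_class d q n (a * b) = yh_class d q n a \<otimes>\<^bsub>yh d q n\<^esub> yh_class d q n b"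
    and yh_class_add: "yh_class d q n (a + b) = yh_class d q n a \<oplus>\<^bsub>yh d q n\<^esub> yh_class d q n b"
  using ring_hom_mult[OF yh_class_hom assms] ring_hom_add[OF yh_class_hom assms] by simp_all

lemma yh_class_1: "yh_class d q n 1 = \<one>\<^bsub>yh d q n\<^esub>"
  using ring_hom_one[OF yh_class_hom] by simp

lemma yh_class_closed [simp]: "a \<in> YF n \<Longrightarrow> yh_class d q n a \<in> carrier (yh d q n)"
  using ring_hom_closed[OF yh_class_hom] by blast

text \<open>
  Calculations take place in the free algebra, an honest ring type, modulo this relation. Membership
  in the carrier is built in since the ideal is one of \<open>yh_free n\<close> only, not of the full free algebra.
\<close>

definition yh_cong :: "nat \<Rightarrow> complex \<Rightarrow> nat \<Rightarrow> yh_gen free_alg \<Rightarrow> yh_gen free_alg \<Rightarrow> bool"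
  where "yh_cong d q n a b \<longleftrightarrow> a \<in> YF n \<and> b \<in> YF n \<and> yh_class d q n a = yh_class d q n b"

lemma yh_cong_iff_diff:
  "yh_cong d q n a b \<longleftrightarrow> a \<in> YF n \<and> b \<in> YF n \<and> a - b \<in> yh_ideal d q n"
  using ring.quotient_eq_iff_same_a_r_cos[OF ring_yh_free ideal_yh_ideal, of a n b d q]
  by (auto simp: yh_cong_def yh_class_def yh_free_minus)

lemma yh_cong_rel:
  assumes "yh_rel d q n a b"
  shows "yh_cong d q n a b"
proof -
  have "{a - b | a b. yh_rel d q n a b} \<subseteq> YF n"
    by (auto dest: yh_rel_in_YF)
  then have "a - b \<in> yh_ideal d q n"
    using ring.genideal_self[OF ring_yh_free] assms unfolding yh_ideal_def by blast
  then show ?thesis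
    using yh_rel_in_YF[OF assms] by (simp add: yh_cong_iff_diff)
qed

text \<open>
  The preimage of the ideal at level \<open>n + 1\<close> in the free algebra at level \<open>n\<close> is an ideal that
  contains the relations of level \<open>n\<close>.
\<close>

lemma yh_cong_Suc:
  assumes "yh_cong d q n a b"
  shows "yh_cong d q (Suc n) a b"
proof -
  have hom: "ring_hom_ring (yh_free n) (yh_free (Suc n)) id"
    by (rule ring_hom_ringI[OF ring_yh_free ring_yh_free]) (auto intro: YF_mono)
  have rel: "yh_rel d q (Suc n) x y" if "yh_rel d q n x y" for x y
    using that by cases (auto intro!: yh_rel.intros yh_rel.t_g[simplified])
  have "x - y \<in> {r \<in> YF n. id r \<in> yh_ideal d q (Suc n)}" if "yh_rel d q n x y" for x y
    using yh_cong_rel[OF rel[OF that]] yh_rel_in_YF[OF that] by (simp add: yh_cong_iff_diff)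
  then have "{a - b | a b. yh_rel d q n a b}
      \<subseteq> {r \<in> YF n. id r \<in> yh_ideal d q (Suc n)}"
    by blast
  then have "yh_ideal d q n \<subseteq> {r \<in> YF n. id r \<in> yh_ideal d q (Suc n)}"
    unfolding yh_ideal_def[of d q n]
    by (intro ring.genideal_minimal[OF ring_yh_free] ring_hom_ring.ideal_vimage[OF hom ideal_yh_ideal])
  then show ?thesis
    using assms YF_mono unfolding yh_cong_iff_diff by (simp add: subset_iff)
qed

lemma yh_class_eq: "a \<in> YF n \<Longrightarrow> yh_class d q n a = {h + a | h. h \<in> yh_ideal d q n}"
  by (simp only: yh_class_def a_r_coset_def' yh_free_simps) blast

text \<open>
  By \<open>yh_cong_Suc\<close> all representatives of a class have the same class at the next level, so the
  union in \<open>yh_incl\<close> is taken over a single set.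
\<close>

lemma yh_incl_class:
  assumes a: "a \<in> YF n"
  shows "yh_incl d q n (yh_class d q n a) = yh_class d q (Suc n) a"
proof -
  have "0 \<in> yh_ideal d q n"
    using additive_subgroup.zero_closed[OF ideal.axioms(1)[OF ideal_yh_ideal]] by simp
  then have "a \<in> yh_class d q n a"
    unfolding yh_class_eq[OF a] by force
  moreover have "yh_class d q (Suc n) b = yh_class d q (Suc n) a" if b: "b \<in> yh_class d q n a" for b
  proof -
    obtain h where h: "h \<in> yh_ideal d q n" "b = h + a"
      using b unfolding yh_class_eq[OF a] by blast
    then have "h \<in> YF n"
      using additive_subgroup.a_subset[OF ideal.axioms(1)[OF ideal_yh_ideal]] by blast
    with h a have "yh_cong d q n b a"
      by (simp add: yh_cong_iff_diff)
    then show ?thesis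
      using yh_cong_Suc by (simp add: yh_cong_def)
  qed
  ultimately have "(\<Union>b\<in>yh_class d q n a. yh_class d q (Suc n) b)
      = (\<Union>b\<in>yh_class d q n a. yh_class d q (Suc n) a)"
    by (intro SUP_cong refl)
  also have "\<dots> = yh_class d q (Suc n) a"
    using \<open>a \<in> yh_class d q n a\<close> by blast
  finally show ?thesis
    unfolding yh_incl_def by simp
qed

lemma yh_cong_refl [simp]: "a \<in> YF n \<Longrightarrow> yh_cong d q n a a"
  and yh_cong_sym: "yh_cong d q n a b \<Longrightarrow> yh_cong d q n b a"
  and yh_cong_trans [trans]: "yh_cong d q n a b \<Longrightarrow> yh_cong d q n b c \<Longrightarrow> yh_cong d q n a c"
  by (auto simp: yh_cong_def)

lemma yh_cong_mult: "yh_cong d q n a a' \<Longrightarrow> yh_cong d q n b b' \<Longrightarrow> yh_cong d q n (a * b) (a' * b')"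
  and yh_cong_add: "yh_cong d q n a a' \<Longrightarrow> yh_cong d q n b b' \<Longrightarrow> yh_cong d q n (a + b) (a' + b')"
  by (simp_all add: yh_cong_def yh_class_mult yh_class_add)

lemma yh_cong_mult_left: "c \<in> YF n \<Longrightarrow> yh_cong d q n a b \<Longrightarrow> yh_cong d q n (c * a) (c * b)"
  and yh_cong_mult_right: "c \<in> YF n \<Longrightarrow> yh_cong d q n a b \<Longrightarrow> yh_cong d q n (a * c) (b * c)"
  by (simp_all add: yh_cong_mult)

lemma yh_cong_diff:
  "yh_cong d q n a a' \<Longrightarrow> yh_cong d q n b b' \<Longrightarrow> yh_cong d q n (a - b) (a' - b')"
  using yh_cong_add[of d q n a a' "- b" "- b'"] yh_cong_mult_left[of "fa_scalar (-1)" n d q b b']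
  by (simp add: fa_scalar_neg_one)

lemma yh_cong_sum:
  "(\<And>x. x \<in> A \<Longrightarrow> yh_cong d q n (f x) (g x)) \<Longrightarrow> yh_cong d q n (sum f A) (sum g A)"
proof (induction A rule: infinite_finite_induct)
  case (insert x A)
  then show ?case by (simp add: yh_cong_add)
qed simp_all

text \<open>
  Congruences of the form \<open>x a \<equiv> a y\<close> say that \<open>a\<close> intertwines left multiplication by \<open>x\<close> with right
  multiplication by \<open>y\<close>. They are stable under products, powers, sums and scalars in \<open>(x, y)\<close> and
  under composition in \<open>a\<close>. All commutation rules below, for polynomials in the framing generators
  and for whole braids, are obtained from the defining relations in this way.
\<close>

lemma yh_intertwine_mult:
  assumes "yh_cong d q n (x * a) (a * y)" "yh_cong d q n (x' * a) (a * y')"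
    "x \<in> YF n" "y' \<in> YF n"
  shows "yh_cong d q n (x * x' * a) (a * (y * y'))"
proof -
  have "yh_cong d q n (x * (x' * a)) (x * (a * y'))"
    using assms by (intro yh_cong_mult_left)
  also have "yh_cong d q n (x * (a * y')) (a * y * y')"
    using yh_cong_mult_right[OF assms(4,1)] by (simp add: mult.assoc)
  finally show ?thesis by (simp add: mult.assoc)
qed

lemma yh_intertwine_trans:
  assumes "yh_cong d q n (x * a) (a * y)" "yh_cong d q n (y * b) (b * z)" "a \<in> YF n" "b \<in> YF n"
  shows "yh_cong d q n (x * (a * b)) (a * b * z)"
proof -
  have "yh_cong d q n (x * a * b) (a * y * b)"
    using assms by (intro yh_cong_mult_right)
  also have "yh_cong d q n (a * y * b) (a * (b * z))"
    using yh_cong_mult_left[OF assms(3,2)] by (simp add: mult.assoc)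
  finally show ?thesis by (simp add: mult.assoc)
qed

lemma yh_intertwine_power:
  assumes "yh_cong d q n (x * a) (a * y)" "x \<in> YF n" "y \<in> YF n" "a \<in> YF n"
  shows "yh_cong d q n (x ^ k * a) (a * y ^ k)"
  by (induction k) (use assms yh_intertwine_mult[OF assms(1)] in simp_all)

lemma yh_intertwine_sum:
  assumes "\<And>s. s \<in> A \<Longrightarrow> yh_cong d q n (x s * a) (a * y s)"
  shows "yh_cong d q n (sum x A * a) (a * sum y A)"
  unfolding sum_distrib_left sum_distrib_right by (intro yh_cong_sum assms)

lemma yh_intertwine_scalar:
  assumes "yh_cong d q n (x * a) (a * y)"
  shows "yh_cong d q n (fa_scalar c * x * a) (a * (fa_scalar c * y))"
  using yh_cong_mult_left[OF fa_scalar_in_YF assms, of c] by (simp add: fa_scalar_left_commute mult.assoc)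

lemma fa_scalar_mult_left: "fa_scalar a * (fa_scalar b * x) = fa_scalar (a * b) * x"
  by (simp add: mult.assoc[symmetric] fa_scalar_simps(3))

section \<open>Idempotents of the framing generators\<close>

text \<open>
  When \<open>r ^ d = 1\<close>, this is the idempotent in the group algebra of the cyclic group generated by
  \<open>yh_t j\<close> that projects to the eigenvalue \<open>r\<close>.
\<close>

definition yh_proj :: "nat \<Rightarrow> complex \<Rightarrow> nat \<Rightarrow> yh_gen free_alg"
  where "yh_proj d r j = (\<Sum>s<d. fa_scalar (inverse r ^ s / of_nat d) * yh_t j ^ s)"

text \<open>
  The factors commute and are idempotent modulo the relations, so the product depends only on the
  set of entries (\<open>projs_cong\<close>). Lists are used because the free algebra is not commutative.
\<close>

definition yh_projs :: "nat \<Rightarrow> complex \<Rightarrow> nat list \<Rightarrow> yh_gen free_alg"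
  where "yh_projs d r xs = prod_list (map (yh_proj d r) xs)"

definition yh_block :: "nat \<Rightarrow> complex \<Rightarrow> nat \<Rightarrow> yh_gen free_alg"
  where "yh_block d r n = yh_projs d r [1..<Suc n]"

text \<open>
  An inverse letter is represented by the element that the quadratic relation gives as the inverse
  of \<open>yh_g i\<close>.
\<close>

fun letter_elem :: "nat \<Rightarrow> complex \<Rightarrow> braid_letter \<Rightarrow> yh_gen free_alg" where
  "letter_elem d q (Sigma i) = yh_g i"
| "letter_elem d q (Sigma_inv i) = yh_g i - fa_scalar (q - inverse q) * yh_e d i"

definition braid_elem :: "nat \<Rightarrow> complex \<Rightarrow> braid_letter list \<Rightarrow> yh_gen free_alg"
  where "braid_elem d q \<alpha> = prod_list (map (letter_elem d q) \<alpha>)"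

lemma braid_elem_simps [simp]:
  "braid_elem d q [] = 1"
  "braid_elem d q (l # \<alpha>) = letter_elem d q l * braid_elem d q \<alpha>"
  "braid_elem d q (\<alpha> @ \<beta>) = braid_elem d q \<alpha> * braid_elem d q \<beta>"
  by (simp_all add: braid_elem_def)

lemma yh_projs_simps [simp]:
  "yh_projs d r [] = 1"
  "yh_projs d r (x # xs) = yh_proj d r x * yh_projs d r xs"
  "yh_projs d r (xs @ ys) = yh_projs d r xs * yh_projs d r ys"
  by (simp_all add: yh_projs_def)

lemma yh_proj_in_YF [simp]: "1 \<le> j \<Longrightarrow> j \<le> n \<Longrightarrow> yh_proj d r j \<in> YF n"
  by (simp add: yh_proj_def)

lemma yh_projs_in_YF [simp]: "set xs \<subseteq> {1..n} \<Longrightarrow> yh_projs d r xs \<in> YF n"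
  by (induction xs) simp_all

lemma yh_block_in_YF [simp]: "yh_block d r n \<in> YF n"
  unfolding yh_block_def by (intro yh_projs_in_YF) auto

lemma yh_block_0: "yh_block d r 0 = 1"
  by (simp add: yh_block_def)

lemma yh_block_Suc: "yh_block d r (Suc n) = yh_block d r n * yh_proj d r (Suc n)"
  by (simp add: yh_block_def upt_Suc_append del: upt_Suc)

lemma letter_elem_in_YF [simp]: "[l] \<in> braid_words n \<Longrightarrow> letter_elem d q l \<in> YF n"
  by (cases l) (auto simp: braid_words_def)

lemma braid_words_ConsD:
  assumes "l # \<alpha> \<in> braid_words n"
  shows "[l] \<in> braid_words n" "\<alpha> \<in> braid_words n"
  using assms by (auto simp: braid_words_def)

lemma braid_elem_in_YF [simp]: "\<alpha> \<in> braid_words n \<Longrightarrow> braid_elem d q \<alpha> \<in> YF n"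
proof (induction \<alpha>)
  case (Cons l \<alpha>)
  then show ?case
    using braid_words_ConsD[OF Cons.prems] by simp
qed simp

text \<open>
  Reflection maps \<open>{..<d}\<close> to \<open>{1..d}\<close>, so the boundary terms at \<open>0\<close> and \<open>d\<close> have to be exchanged.
\<close>

lemma sum_lessThan_reflect:
  fixes f :: "nat \<Rightarrow> 'a::ab_group_add"
  assumes "d > 0"
  shows "(\<Sum>s<d. f (d - s)) = (\<Sum>s<d. f s) + (f d - f 0)"
proof -
  have "(\<Sum>s<d. f (d - s)) = (\<Sum>s=1..d. f s)"
    by (rule sum.reindex_bij_witness[of _ "\<lambda>s. d - s" "\<lambda>s. d - s"]) auto
  moreover have "{..<d} = insert 0 {1..<d}" "{1..d} = insert d {1..<d}"
    using assms by auto
  ultimately show ?thesis by (simp add: algebra_simps)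
qed

locale yokonuma_hecke =
  fixes d :: nat and q :: complex and n :: nat
  assumes d_pos: "d > 0"
begin

abbreviation cong (infix \<open>\<doteq>\<close> 50)
  where "cong \<equiv> yh_cong d q n"

abbreviation "c \<equiv> q - inverse q"

lemma t_comm: "i \<in> {1..n} \<Longrightarrow> j \<in> {1..n} \<Longrightarrow> yh_t i * yh_t j \<doteq> yh_t j * yh_t i"
  by (intro yh_cong_rel yh_rel.t_comm)

lemma t_order: "j \<in> {1..n} \<Longrightarrow> yh_t j ^ d \<doteq> 1"
  by (intro yh_cong_rel yh_rel.t_order)

lemma t_g:
  "1 \<le> i \<Longrightarrow> i < n \<Longrightarrow> j \<in> {1..n} \<Longrightarrow>
    yh_t j * yh_g i \<doteq> yh_g i * yh_t (Transposition.transpose i (i + 1) j)"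
  by (intro yh_cong_rel yh_rel.t_g) auto

lemma g_square: "1 \<le> i \<Longrightarrow> i < n \<Longrightarrow> yh_g i * yh_g i \<doteq> 1 + fa_scalar c * yh_e d i * yh_g i"
  using yh_cong_rel[OF yh_rel.quadratic[of i n d q]] by (simp add: power2_eq_square)

text \<open>
  Passing \<open>yh_g i\<close> interchanges the two framing generators in \<open>yh_e d i\<close>. The interchanged sum is the
  original one with the summation index reflected; the boundary terms agree since both \<open>d\<close>-th powers
  are congruent to one.
\<close>

lemma e_g:
  assumes "1 \<le> i" "i < n"
  shows "yh_e d i * yh_g i \<doteq> yh_g i * yh_e d i"
proof -
  let ?a = "yh_t i" and ?b = "yh_t (i + 1)"
  have in_YF: "?a \<in> YF n" "?b \<in> YF n" "yh_g i \<in> YF n"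
    using assms by simp_all
  have "?a * yh_g i \<doteq> yh_g i * ?b" "?b * yh_g i \<doteq> yh_g i * ?a"
    using t_g[OF assms, of i] t_g[OF assms, of "i + 1"] assms by simp_all
  then have powers: "?a ^ s * ?b ^ (d - s) * yh_g i \<doteq> yh_g i * (?b ^ s * ?a ^ (d - s))" for s
    using in_YF by (intro yh_intertwine_mult yh_intertwine_power) simp_all
  have "(\<Sum>s<d. ?b ^ s * ?a ^ (d - s)) \<doteq> (\<Sum>s<d. ?a ^ (d - s) * ?b ^ s)"
  proof (rule yh_cong_sum)
    fix s
    have "?a * ?b ^ s \<doteq> ?b ^ s * ?a"
      using yh_cong_sym[OF yh_intertwine_power[of d q n ?b ?a ?b s]] t_comm[of "i + 1" i] assms by simp
    then show "?b ^ s * ?a ^ (d - s) \<doteq> ?a ^ (d - s) * ?b ^ s"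
      using in_YF
      by (intro yh_cong_sym[OF yh_intertwine_power[where x = "?a" and y = "?a" and a = "?b ^ s"]]) simp_all
  qed
  also have "(\<Sum>s<d. ?a ^ (d - s) * ?b ^ s) = (\<Sum>s<d. ?a ^ (d - s) * ?b ^ (d - (d - s)))"
    by (intro sum.cong) auto
  also have "\<dots> = (\<Sum>s<d. ?a ^ s * ?b ^ (d - s)) + (?a ^ d - ?b ^ d)"
    using sum_lessThan_reflect[OF d_pos, of "\<lambda>s. ?a ^ s * ?b ^ (d - s)"] by simp
  \<comment> \<open>The boundary terms cancel modulo \<open>t ^ d = 1\<close>.\<close>
  also have "\<dots> \<doteq> (\<Sum>s<d. ?a ^ s * ?b ^ (d - s)) + (1 - 1)"
    using assms in_YF by (intro yh_cong_add yh_cong_diff t_order yh_cong_refl) simp_all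
  finally have "yh_g i * (\<Sum>s<d. ?b ^ s * ?a ^ (d - s)) \<doteq> yh_g i * (\<Sum>s<d. ?a ^ s * ?b ^ (d - s))"
    using in_YF by (intro yh_cong_mult_left) simp_all
  with yh_intertwine_sum[where A = "{..<d}", OF powers]
  have "(\<Sum>s<d. ?a ^ s * ?b ^ (d - s)) * yh_g i \<doteq> yh_g i * (\<Sum>s<d. ?a ^ s * ?b ^ (d - s))"
    by (rule yh_cong_trans)
  then show ?thesis
    unfolding yh_e_def by (rule yh_intertwine_scalar)
qed

lemma g_inverse:
  assumes "1 \<le> i" "i < n"
  shows "letter_elem d q (Sigma_inv i) * yh_g i \<doteq> 1"
    and "yh_g i * letter_elem d q (Sigma_inv i) \<doteq> 1"
proof -
  have in_YF: "yh_g i \<in> YF n" "yh_e d i \<in> YF n"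
    using assms by simp_all
  have "yh_g i * yh_g i - fa_scalar c * yh_e d i * yh_g i
      \<doteq> 1 + fa_scalar c * yh_e d i * yh_g i - fa_scalar c * yh_e d i * yh_g i"
    using in_YF by (intro yh_cong_diff g_square assms) simp_all
  then show left: "letter_elem d q (Sigma_inv i) * yh_g i \<doteq> 1"
    by (simp add: left_diff_distrib)
  have "fa_scalar c * yh_e d i * yh_g i \<doteq> yh_g i * (fa_scalar c * yh_e d i)"
    by (rule yh_intertwine_scalar[OF e_g[OF assms]])
  then have "yh_g i * yh_g i - yh_g i * (fa_scalar c * yh_e d i)
      \<doteq> yh_g i * yh_g i - fa_scalar c * yh_e d i * yh_g i"
    using in_YF by (intro yh_cong_diff yh_cong_sym[of d q n "fa_scalar c * yh_e d i * yh_g i"]) simp_all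
  with left show "yh_g i * letter_elem d q (Sigma_inv i) \<doteq> 1"
    by (simp add: left_diff_distrib right_diff_distrib) (rule yh_cong_trans)
qed

lemma yh_letter_eq:
  assumes "[l] \<in> braid_words n"
  shows "yh_letter d q n l = yh_class d q n (letter_elem d q l)"
proof (cases l)
  case (Sigma_inv i)
  then have i: "1 \<le> i" "i < n"
    using assms by (auto simp: braid_words_def)
  have g: "yh_g i \<in> YF n" "letter_elem d q (Sigma_inv i) \<in> YF n"
    using i assms Sigma_inv by simp_all
  have "yh_class d q n (yh_g i) \<otimes>\<^bsub>yh d q n\<^esub> yh_class d q n (letter_elem d q (Sigma_inv i)) = \<one>\<^bsub>yh d q n\<^esub>"
    "yh_class d q n (letter_elem d q (Sigma_inv i)) \<otimes>\<^bsub>yh d q n\<^esub> yh_class d q n (yh_g i) = \<one>\<^bsub>yh d q n\<^esub>"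
    using g_inverse[OF i] g by (simp_all only: yh_cong_def yh_class_1 flip: yh_class_mult)
  then have "inv\<^bsub>yh d q n\<^esub> (yh_class d q n (yh_g i)) = yh_class d q n (letter_elem d q (Sigma_inv i))"
    using g by (intro monoid.inv_char[OF ring.is_monoid[OF ring_yh]] yh_class_closed)
  then show ?thesis
    by (simp only: Sigma_inv yh_letter.simps)
qed simp

lemma yh_braid_eq:
  assumes "\<alpha> \<in> braid_words n"
  shows "yh_braid d q n \<alpha> = yh_class d q n (braid_elem d q \<alpha>)"
  using assms
proof (induction \<alpha>)
  case Nil
  then show ?case by (simp add: yh_braid_def yh_class_1)
next
  case (Cons l \<alpha>)
  then have l: "[l] \<in> braid_words n" "\<alpha> \<in> braid_words n"
    by (auto dest: braid_words_ConsD)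
  have "yh_braid d q n (l # \<alpha>) = yh_letter d q n l \<otimes>\<^bsub>yh d q n\<^esub> yh_braid d q n \<alpha>"
    by (simp add: yh_braid_def)
  also have "\<dots> = yh_class d q n (letter_elem d q l * braid_elem d q \<alpha>)"
    using l by (simp add: Cons.IH yh_letter_eq yh_class_mult)
  finally show ?case by simp
qed

lemma proj_intertwine:
  assumes "yh_t j * a \<doteq> a * yh_t j'" "a \<in> YF n" "j \<in> {1..n}" "j' \<in> {1..n}"
  shows "yh_proj d r j * a \<doteq> a * yh_proj d r j'"
  unfolding yh_proj_def
  using assms by (intro yh_intertwine_sum yh_intertwine_scalar yh_intertwine_power) simp_all

lemma t_proj_comm:
  assumes "i \<in> {1..n}" "j \<in> {1..n}"
  shows "yh_t j * yh_proj d r i \<doteq> yh_proj d r i * yh_t j"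
  using assms by (intro yh_cong_sym[OF proj_intertwine] t_comm) simp_all

lemma proj_comm:
  assumes "i \<in> {1..n}" "j \<in> {1..n}"
  shows "yh_proj d r j * yh_proj d r i \<doteq> yh_proj d r i * yh_proj d r j"
  using assms by (intro proj_intertwine t_proj_comm) simp_all

lemma letter_perm_in: "[l] \<in> braid_words n \<Longrightarrow> j \<in> {1..n} \<Longrightarrow> letter_perm l j \<in> {1..n}"
  using letter_perm_image[of l n] by blast

text \<open>
  For a positive letter this is the defining relation between framings and braiding generators. For
  an inverse letter \<open>h\<close> one multiplies the relation for \<open>yh_g i\<close> by \<open>h\<close> on both sides.
\<close>

lemma proj_letter:
  assumes l: "[l] \<in> braid_words n" and j: "j \<in> {1..n}"
  shows "yh_proj d r j * letter_elem d q l \<doteq> letter_elem d q l * yh_proj d r (letter_perm l j)"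
proof (cases l)
  case (Sigma i)
  then show ?thesis
    using assms letter_perm_in[OF l j] t_g[of i j]
    by (intro proj_intertwine) (auto simp: braid_words_def)
next
  case (Sigma_inv i)
  then have i: "1 \<le> i" "i < n"
    using l by (auto simp: braid_words_def)
  let ?h = "letter_elem d q (Sigma_inv i)" and ?j = "letter_perm l j"
  have j': "?j \<in> {1..n}" by (rule letter_perm_in[OF l j])
  have in_YF: "?h \<in> YF n" "yh_g i \<in> YF n" "yh_proj d r j \<in> YF n" "yh_proj d r ?j \<in> YF n"
    using l i j j' Sigma_inv by simp_all
  have return: "yh_t ?j * yh_g i \<doteq> yh_g i * yh_t j"
    using t_g[OF i j'] Sigma_inv by simp
  have "yh_proj d r ?j * yh_g i \<doteq> yh_g i * yh_proj d r j"
    by (rule proj_intertwine[OF return in_YF(2) j' j])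
  then have mid: "?h * (yh_proj d r ?j * yh_g i) * ?h \<doteq> ?h * (yh_g i * yh_proj d r j) * ?h"
    using in_YF by (intro yh_cong_mult_left yh_cong_mult_right)
  have "yh_proj d r j * ?h = 1 * (yh_proj d r j * ?h)" by simp
  also have "1 * (yh_proj d r j * ?h) \<doteq> ?h * yh_g i * (yh_proj d r j * ?h)"
    using in_YF by (intro yh_cong_mult_right yh_cong_sym[OF g_inverse(1)[OF i]]) simp_all
  also have "?h * yh_g i * (yh_proj d r j * ?h) = ?h * (yh_g i * yh_proj d r j) * ?h"
    by (simp only: mult.assoc)
  also have "\<dots> \<doteq> ?h * (yh_proj d r ?j * yh_g i) * ?h"
    by (rule yh_cong_sym[OF mid])
  also have "\<dots> = ?h * yh_proj d r ?j * (yh_g i * ?h)"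
    by (simp only: mult.assoc)
  also have "\<dots> \<doteq> ?h * yh_proj d r ?j * 1"
    using in_YF by (intro yh_cong_mult_left g_inverse(2)[OF i]) simp_all
  finally show ?thesis
    by (simp only: Sigma_inv mult_1_right)
qed

lemma proj_braid:
  assumes "\<alpha> \<in> braid_words n" "j \<in> {1..n}"
  shows "yh_proj d r j * braid_elem d q \<alpha> \<doteq> braid_elem d q \<alpha> * yh_proj d r (braid_perm \<alpha> j)"
  using assms
proof (induction \<alpha> arbitrary: j)
  case (Cons l \<alpha>)
  then have l: "[l] \<in> braid_words n" "\<alpha> \<in> braid_words n"
    by (auto dest: braid_words_ConsD)
  have "letter_perm l j \<in> {1..n}"
    using letter_perm_in[OF l(1) Cons.prems(2)] .
  then show ?case
    using yh_intertwine_trans[OF proj_letter[OF l(1) Cons.prems(2)] Cons.IH[OF l(2)]] l by simp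
qed simp

lemma proj_projs_comm:
  assumes "j \<in> {1..n}" "set xs \<subseteq> {1..n}"
  shows "yh_proj d r j * yh_projs d r xs \<doteq> yh_projs d r xs * yh_proj d r j"
  using assms(2)
proof (induction xs)
  case (Cons x xs)
  then show ?case
    using yh_intertwine_trans[OF proj_comm Cons.IH] assms(1) by simp
qed (use assms in simp)

lemma projs_comm:
  assumes "set xs \<subseteq> {1..n}" "set ys \<subseteq> {1..n}"
  shows "yh_projs d r xs * yh_projs d r ys \<doteq> yh_projs d r ys * yh_projs d r xs"
  using assms(1)
proof (induction xs)
  case (Cons x xs)
  then show ?case
    using yh_intertwine_mult[OF proj_projs_comm Cons.IH] assms(2) by simp
qed (use assms in simp)

lemma projs_braid:
  assumes \<alpha>: "\<alpha> \<in> braid_words n" and "set xs \<subseteq> {1..n}"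
  shows "yh_projs d r xs * braid_elem d q \<alpha>
    \<doteq> braid_elem d q \<alpha> * yh_projs d r (map (braid_perm \<alpha>) xs)"
  using assms(2)
proof (induction xs)
  case (Cons x xs)
  have "braid_perm \<alpha> y \<in> {1..n}" if "y \<in> {1..n}" for y
    using imageI[OF that, of "braid_perm \<alpha>"] by (simp only: braid_perm_image[OF \<alpha>])
  with Cons.prems have "set (map (braid_perm \<alpha>) xs) \<subseteq> {1..n}"
    by auto
  then show ?case
    using yh_intertwine_mult[OF proj_braid[OF \<alpha>] Cons.IH] Cons.prems by simp
qed (use \<alpha> in simp)

context
  fixes r :: complex
  assumes root: "r ^ d = 1"
begin

lemma root_ne_0: "r \<noteq> 0"
  using root d_pos by (auto simp: power_0_left)

lemma t_proj:
  assumes "j \<in> {1..n}"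
  shows "yh_t j * yh_proj d r j \<doteq> fa_scalar r * yh_proj d r j"
proof -
  let ?f = "\<lambda>s. fa_scalar (inverse r ^ s / of_nat d) * yh_t j ^ s"
  have "yh_t j * yh_proj d r j = fa_scalar r * (\<Sum>s<d. ?f (Suc s))"
    unfolding yh_proj_def sum_distrib_left
  proof (rule sum.cong)
    fix s
    have coeff: "r * (inverse r ^ Suc s / of_nat d) = inverse r ^ s / of_nat d"
      using root_ne_0 by simp
    show "yh_t j * (fa_scalar (inverse r ^ s / of_nat d) * yh_t j ^ s) = fa_scalar r * ?f (Suc s)"
      by (simp only: fa_scalar_mult_left coeff fa_scalar_left_commute[of "yh_t j"]) (simp only: power_Suc)
  qed simp
  also have "(\<Sum>s<d. ?f (Suc s)) = yh_proj d r j + (?f d - ?f 0)"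
    unfolding yh_proj_def
    using sum.lessThan_Suc[of ?f d] sum.lessThan_Suc_shift[of ?f d] by (simp only: algebra_simps)
  also have "fa_scalar r * \<dots> \<doteq> fa_scalar r * (yh_proj d r j + (?f 0 - ?f 0))"
  proof (intro yh_cong_mult_left yh_cong_add yh_cong_diff)
    have "fa_scalar (1 / of_nat d) * yh_t j ^ d \<doteq> fa_scalar (1 / of_nat d) * 1"
      using assms by (intro yh_cong_mult_left t_order) simp_all
    then show "?f d \<doteq> ?f 0"
      using root by (simp add: power_inverse)
  qed (use assms in simp_all)
  also have "fa_scalar r * (yh_proj d r j + (?f 0 - ?f 0)) = fa_scalar r * yh_proj d r j"
    by simp
  finally show ?thesis .
qed

lemma t_power_proj:
  assumes "j \<in> {1..n}"
  shows "yh_t j ^ s * yh_proj d r j \<doteq> fa_scalar (r ^ s) * yh_proj d r j"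
proof (induction s)
  case 0
  then show ?case using assms by (simp add: fa_scalar_simps)
next
  case (Suc s)
  have "yh_t j * (yh_t j ^ s * yh_proj d r j) \<doteq> yh_t j * (fa_scalar (r ^ s) * yh_proj d r j)"
    using assms Suc by (intro yh_cong_mult_left) simp_all
  also have "yh_t j * (fa_scalar (r ^ s) * yh_proj d r j) = fa_scalar (r ^ s) * (yh_t j * yh_proj d r j)"
    by (rule fa_scalar_left_commute)
  also have "\<dots> \<doteq> fa_scalar (r ^ s) * (fa_scalar r * yh_proj d r j)"
    using assms by (intro yh_cong_mult_left t_proj) simp_all
  also have "\<dots> = fa_scalar (r ^ Suc s) * yh_proj d r j"
    by (simp only: fa_scalar_mult_left power_Suc2)
  finally show ?case by (simp add: mult.assoc)
qed

lemma proj_idem: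
  assumes "j \<in> {1..n}"
  shows "yh_proj d r j * yh_proj d r j \<doteq> yh_proj d r j"
proof -
  let ?p = "yh_proj d r j"
  have "?p * ?p = (\<Sum>s<d. fa_scalar (inverse r ^ s / of_nat d) * (yh_t j ^ s * ?p))"
    by (subst (1) yh_proj_def) (simp add: sum_distrib_right mult.assoc)
  also have "\<dots> \<doteq> (\<Sum>s<d. fa_scalar (inverse r ^ s / of_nat d) * (fa_scalar (r ^ s) * ?p))"
    using assms by (intro yh_cong_sum yh_cong_mult_left t_power_proj) simp_all
  also have "\<dots> = (\<Sum>s<d. fa_scalar (1 / of_nat d) * ?p)"
  proof (rule sum.cong)
    fix s
    have "inverse r ^ s / of_nat d * r ^ s = 1 / of_nat d"
      using root_ne_0 by (simp flip: power_mult_distrib)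
    then show "fa_scalar (inverse r ^ s / of_nat d) * (fa_scalar (r ^ s) * ?p) = fa_scalar (1 / of_nat d) * ?p"
      by (simp only: fa_scalar_mult_left)
  qed simp
  also have "\<dots> = fa_scalar (\<Sum>s<d. 1 / of_nat d) * ?p"
    by (simp only: fa_scalar_sum sum_distrib_right)
  also have "\<dots> = ?p"
    using d_pos by (simp add: fa_scalar_simps)
  finally show ?thesis .
qed

lemma proj_absorb:
  assumes "x \<in> set xs" "set xs \<subseteq> {1..n}"
  shows "yh_proj d r x * yh_projs d r xs \<doteq> yh_projs d r xs"
  using assms
proof (induction xs)
  case (Cons y ys)
  have y: "y \<in> {1..n}" "set ys \<subseteq> {1..n}" and x: "x \<in> {1..n}"
    using Cons.prems by auto
  show ?case
  proof (cases "x = y")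
    case True
    have "yh_proj d r x * yh_proj d r y * yh_projs d r ys \<doteq> yh_proj d r y * yh_projs d r ys"
      unfolding True using y by (intro yh_cong_mult_right proj_idem) simp_all
    then show ?thesis by (simp add: mult.assoc)
  next
    case False
    have "yh_proj d r x * yh_proj d r y * yh_projs d r ys \<doteq> yh_proj d r y * yh_proj d r x * yh_projs d r ys"
      using x y by (intro yh_cong_mult_right proj_comm) simp_all
    also have "yh_proj d r y * yh_proj d r x * yh_projs d r ys
        = yh_proj d r y * (yh_proj d r x * yh_projs d r ys)"
      by (rule mult.assoc)
    also have "\<dots> \<doteq> yh_proj d r y * yh_projs d r ys"
      using y Cons.prems False by (intro yh_cong_mult_left Cons.IH) auto
    finally show ?thesis by (simp add: mult.assoc)
  qed
qed simp

lemma projs_absorb: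
  assumes "set ys \<subseteq> set xs" "set xs \<subseteq> {1..n}"
  shows "yh_projs d r ys * yh_projs d r xs \<doteq> yh_projs d r xs"
  using assms(1)
proof (induction ys)
  case (Cons y ys)
  have "yh_proj d r y * (yh_projs d r ys * yh_projs d r xs) \<doteq> yh_proj d r y * yh_projs d r xs"
    using Cons assms(2) by (intro yh_cong_mult_left) auto
  also have "\<dots> \<doteq> yh_projs d r xs"
    using Cons.prems assms(2) by (intro proj_absorb) auto
  finally show ?case by (simp add: mult.assoc)
qed (use assms in simp)

text \<open>Each of two products with the same factors absorbs the other one, and they commute.\<close>

lemma projs_cong:
  assumes "set xs = set ys" "set xs \<subseteq> {1..n}"
  shows "yh_projs d r xs \<doteq> yh_projs d r ys"
proof -
  have "yh_projs d r xs \<doteq> yh_projs d r ys * yh_projs d r xs"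
    using assms by (intro yh_cong_sym[OF projs_absorb]) auto
  also have "\<dots> \<doteq> yh_projs d r xs * yh_projs d r ys"
    using assms by (intro projs_comm) auto
  also have "\<dots> \<doteq> yh_projs d r ys"
    using assms by (intro projs_absorb) auto
  finally show ?thesis .
qed

abbreviation "Q \<equiv> yh_block d r n"

lemma projs_eq_block:
  assumes "set xs = {1..n}"
  shows "yh_projs d r xs \<doteq> Q"
  unfolding yh_block_def using projs_cong[of xs "[1..<Suc n]"] assms
  by (simp add: atLeastLessThanSuc_atLeastAtMost del: upt_Suc)

lemma proj_block:
  assumes "j \<in> {1..n}"
  shows "yh_proj d r j * Q \<doteq> Q"
  unfolding yh_block_def using assms by (intro proj_absorb) auto

text \<open>A permutation of all strands does not change the set of factors of the full product.\<close>

lemma block_braid_comm: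
  assumes "\<alpha> \<in> braid_words n"
  shows "Q * braid_elem d q \<alpha> \<doteq> braid_elem d q \<alpha> * Q"
proof -
  have set: "set [1..<Suc n] = {1..n}" by auto
  have "set (map (braid_perm \<alpha>) [1..<Suc n]) = {1..n}"
    by (simp only: set_map set braid_perm_image[OF assms])
  then have "yh_projs d r (map (braid_perm \<alpha>) [1..<Suc n]) \<doteq> Q"
    by (rule projs_eq_block)
  then have "braid_elem d q \<alpha> * yh_projs d r (map (braid_perm \<alpha>) [1..<Suc n]) \<doteq> braid_elem d q \<alpha> * Q"
    using assms by (intro yh_cong_mult_left) simp_all
  moreover have "Q * braid_elem d q \<alpha> \<doteq> braid_elem d q \<alpha> * yh_projs d r (map (braid_perm \<alpha>) [1..<Suc n])"
    unfolding yh_block_def by (intro projs_braid assms) auto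
  ultimately show ?thesis
    using yh_cong_trans by blast
qed

lemma t_power_block:
  assumes "j \<in> {1..n}"
  shows "yh_t j ^ s * Q \<doteq> fa_scalar (r ^ s) * Q"
proof -
  have absorb: "Q \<doteq> yh_proj d r j * Q"
    by (rule yh_cong_sym[OF proj_block[OF assms]])
  have "yh_t j ^ s * Q \<doteq> yh_t j ^ s * (yh_proj d r j * Q)"
    using assms absorb by (intro yh_cong_mult_left) simp_all
  also have "yh_t j ^ s * (yh_proj d r j * Q) = yh_t j ^ s * yh_proj d r j * Q"
    by (rule mult.assoc[symmetric])
  also have "\<dots> \<doteq> fa_scalar (r ^ s) * yh_proj d r j * Q"
    by (rule yh_cong_mult_right[OF yh_block_in_YF t_power_proj[OF assms]])
  also have "\<dots> = fa_scalar (r ^ s) * (yh_proj d r j * Q)"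
    by (rule mult.assoc)
  also have "\<dots> \<doteq> fa_scalar (r ^ s) * Q"
    by (rule yh_cong_mult_left[OF fa_scalar_in_YF yh_cong_sym[OF absorb]])
  finally show ?thesis .
qed

text \<open>
  Next to the full product all framing generators act as the same scalar \<open>r\<close>, hence each summand
  of \<open>yh_e d i\<close> acts as \<open>r ^ s * r ^ (d - s) = 1\<close>.
\<close>

lemma e_block:
  assumes "1 \<le> i" "i < n"
  shows "yh_e d i * Q \<doteq> Q"
proof -
  have "yh_t i ^ s * yh_t (i + 1) ^ (d - s) * Q \<doteq> Q" if "s < d" for s
  proof -
    have "yh_t i ^ s * (yh_t (i + 1) ^ (d - s) * Q) \<doteq> yh_t i ^ s * (fa_scalar (r ^ (d - s)) * Q)"
      using assms by (intro yh_cong_mult_left[OF _ t_power_block]) simp_all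
    also have "yh_t i ^ s * (fa_scalar (r ^ (d - s)) * Q) = fa_scalar (r ^ (d - s)) * (yh_t i ^ s * Q)"
      by (rule fa_scalar_left_commute)
    also have "\<dots> \<doteq> fa_scalar (r ^ (d - s)) * (fa_scalar (r ^ s) * Q)"
      using assms by (intro yh_cong_mult_left[OF _ t_power_block]) simp_all
    also have "\<dots> = fa_scalar (r ^ (d - s + s)) * Q"
      by (simp only: fa_scalar_mult_left power_add)
    also have "\<dots> = Q"
      using that root by (simp add: fa_scalar_simps)
    finally show ?thesis by (simp add: mult.assoc)
  qed
  then have "(\<Sum>s<d. yh_t i ^ s * yh_t (i + 1) ^ (d - s) * Q) \<doteq> (\<Sum>s<d. Q)"
    by (intro yh_cong_sum) simp
  then have "fa_scalar (1 / of_nat d) * (\<Sum>s<d. yh_t i ^ s * yh_t (i + 1) ^ (d - s) * Q)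
      \<doteq> fa_scalar (1 / of_nat d) * (\<Sum>s<d. Q)"
    by (intro yh_cong_mult_left) simp_all
  also have "fa_scalar (1 / of_nat d) * (\<Sum>s<d. Q) = fa_scalar (\<Sum>s<d. 1 / of_nat d) * Q"
    by (simp only: fa_scalar_sum sum_distrib_right sum_distrib_left)
  also have "\<dots> = Q"
    using d_pos by (simp add: fa_scalar_simps)
  finally show ?thesis
    by (simp add: yh_e_def sum_distrib_right mult.assoc del: upt_Suc)
qed

text \<open>
  The full product commutes with braids and with framings, so it can be moved next to \<open>yh_e d i\<close> and
  back, and there it absorbs this factor. This is the step that replaces the quadratic relation of Yokonuma--Hecke type by the one of Hecke type.
\<close>

lemma block_e_cancel:
  assumes i: "1 \<le> i" "i < n" and u: "u \<in> braid_words n" and v: "v \<in> YF n"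
  shows "Q * (braid_elem d q u * (yh_e d i * v)) \<doteq> Q * (braid_elem d q u * v)"
proof -
  let ?u = "braid_elem d q u"
  have e_comm: "Q * yh_e d i \<doteq> yh_e d i * Q"
  proof -
    have "yh_proj d r j * yh_e d i \<doteq> yh_e d i * yh_proj d r j" if j: "j \<in> {1..n}" for j
    proof -
      have "yh_t k ^ m * yh_proj d r j \<doteq> yh_proj d r j * yh_t k ^ m" if "k \<in> {1..n}" for k m
        using that j by (intro yh_intertwine_power t_proj_comm) simp_all
      then have "(\<Sum>s<d. yh_t i ^ s * yh_t (i + 1) ^ (d - s)) * yh_proj d r j
          \<doteq> yh_proj d r j * (\<Sum>s<d. yh_t i ^ s * yh_t (i + 1) ^ (d - s))"
        using i by (intro yh_intertwine_sum yh_intertwine_mult) simp_all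
      then show ?thesis
        unfolding yh_e_def by (intro yh_cong_sym[OF yh_intertwine_scalar])
    qed
    then have "yh_projs d r xs * yh_e d i \<doteq> yh_e d i * yh_projs d r xs" if "set xs \<subseteq> {1..n}" for xs
      using that
    proof (induction xs)
      case (Cons x xs)
      then show ?case
        using yh_intertwine_mult[OF Cons.prems(1)[of x] Cons.IH] i by simp
    qed (use i in simp)
    from this[of "[1..<Suc n]"] show ?thesis
      unfolding yh_block_def by (simp add: subset_iff del: upt_Suc)
  qed
  have in_YF: "?u \<in> YF n" "yh_e d i \<in> YF n"
    using u i by simp_all
  have "Q * ?u * (yh_e d i * v) \<doteq> ?u * Q * (yh_e d i * v)"
    using in_YF v by (intro yh_cong_mult_right[OF _ block_braid_comm[OF u]]) simp_all
  also have "?u * Q * (yh_e d i * v) = ?u * (Q * yh_e d i) * v"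
    by (simp only: mult.assoc)
  also have "\<dots> \<doteq> ?u * Q * v"
    by (rule yh_cong_mult_right[OF v yh_cong_mult_left[OF in_YF(1) yh_cong_trans[OF e_comm e_block[OF i]]]])
  also have "\<dots> \<doteq> Q * ?u * v"
    by (rule yh_cong_mult_right[OF v yh_cong_sym[OF block_braid_comm[OF u]]])
  finally show ?thesis by (simp only: mult.assoc)
qed

end

end

section \<open>Roots of unity\<close>

definition unity_root :: "nat \<Rightarrow> nat \<Rightarrow> complex"
  where "unity_root d k = exp (2 * of_real pi * \<i> * of_nat k / of_nat d)"

lemma unity_root_power: "unity_root d k ^ s = exp (2 * of_real pi * \<i> * of_nat s * of_nat k / of_nat d)"
  by (simp add: unity_root_def exp_of_nat_mult[symmetric] algebra_simps)

lemma unity_root_power_d [simp]: "d > 0 \<Longrightarrow> unity_root d k ^ d = 1"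
  using complex_root_unity_eq_1[of d "d * k"] by (simp add: unity_root_power)

lemma unity_root_inj:
  "k < d \<Longrightarrow> m < d \<Longrightarrow> unity_root d k = unity_root d m \<Longrightarrow> k = m"
  using complex_root_unity_eq[of d k m] by (simp add: unity_root_def)

lemma unity_root_0 [simp]: "unity_root d 0 = 1"
  by (simp add: unity_root_def)

lemma unity_root_ne_0 [simp]: "unity_root d k \<noteq> 0"
  by (simp add: unity_root_def)

lemma sum_powers_root_of_unity:
  fixes x :: complex
  assumes "x ^ d = 1"
  shows "(\<Sum>s<d. x ^ s) = (if x = 1 then of_nat d else 0)"
  using assms one_diff_power_eq[of x d] by auto

text \<open>Orthogonality of the characters of the cyclic group of order \<open>d\<close>.\<close>

lemma unity_root_orthogonal:
  assumes "k < d" "m < d"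
  shows "(\<Sum>s<d. (inverse (unity_root d k) * unity_root d m) ^ s) = (if k = m then of_nat d else 0)"
proof -
  let ?x = "inverse (unity_root d k) * unity_root d m"
  have "?x ^ d = 1"
    using assms by (simp add: power_mult_distrib power_inverse)
  moreover have "?x = 1 \<longleftrightarrow> k = m"
    using unity_root_inj[OF assms] by (auto simp: field_simps)
  ultimately show ?thesis
    using sum_powers_root_of_unity[of ?x d] by simp
qed

text \<open>
  The coefficient of \<open>yh_t j ^ s\<close> in the sum is the average of a character over the roots of unity,
  and for \<open>s < d\<close> this character is trivial only if \<open>s = 0\<close>. The identity therefore holds already in
  the free algebra.
\<close>

lemma sum_proj_unity_roots:
  assumes "d > 0"
  shows "(\<Sum>k<d. yh_proj d (unity_root d k) j) = 1"
proof -
  have coeff: "(\<Sum>k<d. inverse (unity_root d k) ^ s / of_nat d) = (if s = 0 then 1 else 0)" if "s < d" for s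
  proof -
    have "inverse (unity_root d k) ^ s = (inverse (unity_root d s) * unity_root d 0) ^ k" for k
      by (simp add: unity_root_power power_inverse mult.commute mult.left_commute)
    then have "(\<Sum>k<d. inverse (unity_root d k) ^ s) = (if s = 0 then of_nat d else 0)"
      using unity_root_orthogonal[OF that assms] by simp
    then show ?thesis
      using assms by (simp flip: sum_divide_distrib)
  qed
  have "(\<Sum>k<d. yh_proj d (unity_root d k) j)
      = (\<Sum>s<d. fa_scalar (\<Sum>k<d. inverse (unity_root d k) ^ s / of_nat d) * yh_t j ^ s)"
    unfolding yh_proj_def fa_scalar_sum sum_distrib_right by (rule sum.swap)
  also have "\<dots> = (\<Sum>s<d. if s = 0 then 1 else 0)"
    using coeff by (intro sum.cong) (auto simp: fa_scalar_simps)
  also have "\<dots> = 1"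
    using assms by simp
  finally show ?thesis .
qed

section \<open>The trace on one block\<close>

lemma braid_perm_above:
  "\<alpha> \<in> braid_words n \<Longrightarrow> braid_perm \<alpha> (Suc n) = Suc n"
proof (induction \<alpha>)
  case (Cons l \<alpha>)
  then have "letter_perm l (Suc n) = Suc n"
    by (cases l) (auto simp: braid_words_def Transposition.transpose_def)
  then show ?case
    using Cons.IH braid_words_ConsD[OF Cons.prems] by simp
qed simp

lemma braid_words_Suc: "\<alpha> \<in> braid_words n \<Longrightarrow> \<alpha> \<in> braid_words (Suc n)"
  by (auto simp: braid_words_def)

locale yh_trace =
  fixes d :: nat and D :: "nat set" and q :: complex
    and tr :: "nat \<Rightarrow> yh_gen free_alg set \<Rightarrow> complex poly"
  assumes d_pos: "d > 0" and D_sub: "D \<subseteq> {0..<d}" and D_ne: "D \<noteq> {}"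
    and trace: "specialized_trace d D q tr"
begin

lemmas yh = yokonuma_hecke.intro[OF d_pos]

lemmas trace_conjs = trace[unfolded specialized_trace_def]
lemmas trace_incl = trace_conjs[THEN conjunct1, rule_format]
lemmas trace_add = trace_conjs[THEN conjunct2, THEN conjunct1, rule_format]
lemmas trace_scalar = trace_conjs[THEN conjunct2, THEN conjunct2, THEN conjunct1, rule_format]
lemmas trace_comm = trace_conjs[THEN conjunct2, THEN conjunct2, THEN conjunct2, THEN conjunct1, rule_format]
lemmas trace_one = trace_conjs[THEN conjunct2, THEN conjunct2, THEN conjunct2, THEN conjunct2,
    THEN conjunct1, rule_format]
lemmas trace_g = trace_conjs[THEN conjunct2, THEN conjunct2, THEN conjunct2, THEN conjunct2,
    THEN conjunct2, THEN conjunct1, rule_format]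
lemmas trace_t = trace_conjs[THEN conjunct2, THEN conjunct2, THEN conjunct2, THEN conjunct2,
    THEN conjunct2, THEN conjunct2, rule_format]

text \<open>The trace, read as a function of representatives in the free algebra.\<close>

definition val :: "nat \<Rightarrow> yh_gen free_alg \<Rightarrow> complex poly"
  where "val n a = tr n (yh_class d q n a)"

lemma val_cong: "yh_cong d q n a b \<Longrightarrow> val n a = val n b"
  by (simp add: val_def yh_cong_def)

lemma val_add: "a \<in> YF n \<Longrightarrow> b \<in> YF n \<Longrightarrow> val n (a + b) = val n a + val n b"
  by (simp add: val_def yh_class_add trace_add)

lemma val_scalar: "a \<in> YF n \<Longrightarrow> val n (fa_scalar k * a) = Polynomial.smult k (val n a)"
  by (simp add: val_def yh_class_mult trace_scalar)

lemma val_comm: "a \<in> YF n \<Longrightarrow> b \<in> YF n \<Longrightarrow> val n (a * b) = val n (b * a)"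
  by (simp add: val_def yh_class_mult trace_comm)

lemma val_1: "val n 1 = 1"
  by (simp add: val_def yh_class_1 trace_one)

lemma val_0: "val n 0 = 0"
  using val_scalar[of 0 n 0] by simp

lemma val_diff: "a \<in> YF n \<Longrightarrow> b \<in> YF n \<Longrightarrow> val n (a - b) = val n a - val n b"
  using val_add[of "a - b" n b] by (simp add: algebra_simps)

lemma val_sum: "(\<And>x. x \<in> A \<Longrightarrow> f x \<in> YF n) \<Longrightarrow> val n (sum f A) = (\<Sum>x\<in>A. val n (f x))"
  by (induction A rule: infinite_finite_induct) (simp_all add: val_0 val_add)

lemma val_Suc: "a \<in> YF n \<Longrightarrow> val (Suc n) a = val n a"
  using trace_incl[of "yh_class d q n a" n] by (simp add: val_def yh_incl_class)

lemma val_g: "n \<ge> 1 \<Longrightarrow> a \<in> YF n \<Longrightarrow> val (Suc n) (a * yh_g n) = [:0, 1:] * val n a"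
  using trace_g[of n "yh_class d q n a"]
  by (simp add: val_def yh_incl_class yh_class_mult YF_mono)

lemma E_sol_0: "E_sol d D 0 = 1"
  using D_ne finite_subset[OF D_sub] by (simp add: E_sol_def)

lemma val_t:
  assumes "a \<in> YF n" "s < d"
  shows "val (Suc n) (a * yh_t (Suc n) ^ s) = Polynomial.smult (E_sol d D s) (val n a)"
proof (cases "s = 0")
  case True
  then show ?thesis
    using assms by (simp add: val_Suc E_sol_0)
next
  case False
  then show ?thesis
    using assms trace_t[of "yh_class d q n a" n s]
    by (simp add: val_def yh_incl_class yh_class_mult YF_mono)
qed

text \<open>
  The trace of \<open>yh_proj d r j\<close>: a discrete Fourier coefficient of the solution of the E-system
  attached to \<open>D\<close>.
\<close>

definition weight :: "complex \<Rightarrow> complex"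
  where "weight r = (\<Sum>s<d. inverse r ^ s / of_nat d * E_sol d D s)"

lemma val_proj:
  assumes "a \<in> YF n"
  shows "val (Suc n) (a * yh_proj d r (Suc n)) = Polynomial.smult (weight r) (val n a)"
proof -
  have a: "a \<in> YF (Suc n)" by (rule YF_mono[OF assms])
  have "val (Suc n) (a * yh_proj d r (Suc n))
      = val (Suc n) (\<Sum>s<d. fa_scalar (inverse r ^ s / of_nat d) * (a * yh_t (Suc n) ^ s))"
    by (simp only: yh_proj_def sum_distrib_left fa_scalar_left_commute[of a])
  also have "\<dots> = (\<Sum>s<d. Polynomial.smult (inverse r ^ s / of_nat d * E_sol d D s) (val n a))"
    using a assms by (subst val_sum) (simp_all add: val_scalar val_t)
  also have "\<dots> = Polynomial.smult (weight r) (val n a)"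
    by (simp only: weight_def smult_sum)
  finally show ?thesis .
qed

text \<open>
  The solution of the E-system is the inverse Fourier transform of the uniform distribution on \<open>D\<close>;
  its Fourier coefficients give back this distribution.
\<close>

lemma weight_unity_root:
  assumes "k < d"
  shows "weight (unity_root d k) = (if k \<in> D then 1 / of_nat (card D) else 0)"
proof -
  have fin: "finite D"
    using finite_subset[OF D_sub] by simp
  have "weight (unity_root d k)
      = (\<Sum>s<d. \<Sum>m\<in>D. (inverse (unity_root d k) * unity_root d m) ^ s / (of_nat d * of_nat (card D)))"
    by (simp add: weight_def E_sol_def unity_root_power[symmetric] sum_distrib_left power_mult_distrib
        sum_divide_distrib)
  also have "\<dots> = (\<Sum>m\<in>D. \<Sum>s<d. (inverse (unity_root d k) * unity_root d m) ^ s / (of_nat d * of_nat (card D)))"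
    by (rule sum.swap)
  also have "\<dots> = (\<Sum>m\<in>D. (if k = m then of_nat d else 0) / (of_nat d * of_nat (card D)))"
  proof (rule sum.cong)
    fix m assume "m \<in> D"
    then have "m < d" using D_sub by auto
    then show "(\<Sum>s<d. (inverse (unity_root d k) * unity_root d m) ^ s / (of_nat d * of_nat (card D)))
        = (if k = m then of_nat d else 0) / (of_nat d * of_nat (card D))"
      by (simp only: unity_root_orthogonal[OF assms] flip: sum_divide_distrib)
  qed simp
  also have "\<dots> = (\<Sum>m\<in>D. if k = m then 1 / of_nat (card D) else 0)"
    using d_pos by (intro sum.cong) auto
  also have "\<dots> = (if k \<in> D then 1 / of_nat (card D) else 0)"
    using fin by simp
  finally show ?thesis .
qed

definition block_trace :: "complex \<Rightarrow> nat \<Rightarrow> braid_letter list \<Rightarrow> complex poly"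
  where "block_trace r n \<alpha> = val n (yh_block d r n * braid_elem d q \<alpha>)"

lemma val_block_cong:
  assumes "u \<in> braid_words n" "v \<in> braid_words n" "yh_cong d q n x y"
  shows "val n (yh_block d r n * (braid_elem d q u * (x * braid_elem d q v)))
    = val n (yh_block d r n * (braid_elem d q u * (y * braid_elem d q v)))"
  using assms by (intro val_cong yh_cong_mult_left yh_cong_mult_right yh_block_in_YF) simp_all

context
  fixes r :: complex
  assumes root: "r ^ d = 1"
begin

lemma block_trace_quadratic:
  assumes "1 \<le> i" "i < n" "u \<in> braid_words n" "v \<in> braid_words n"
  shows "block_trace r n (u @ [Sigma i, Sigma i] @ v)
    = block_trace r n (u @ v) + [:q - inverse q:] * block_trace r n (u @ [Sigma i] @ v)"
proof -
  let ?F = "yh_block d r n" and ?u = "braid_elem d q u" and ?v = "braid_elem d q v"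
  let ?c = "q - inverse q"
  have in_YF: "?u \<in> YF n" "?v \<in> YF n" "yh_g i \<in> YF n" "yh_e d i \<in> YF n"
    using assms by simp_all
  have "val n (?F * (?u * ((yh_g i * yh_g i) * ?v)))
      = val n (?F * (?u * ((1 + fa_scalar ?c * yh_e d i * yh_g i) * ?v)))"
    using assms by (intro val_block_cong yokonuma_hecke.g_square[OF yh])
  also have "?F * (?u * ((1 + fa_scalar ?c * yh_e d i * yh_g i) * ?v))
      = ?F * (?u * ?v) + fa_scalar ?c * (?F * (?u * (yh_e d i * (yh_g i * ?v))))"
    by (simp only: distrib_left distrib_right mult_1_left mult.assoc fa_scalar_left_commute[of ?u]
        fa_scalar_left_commute[of ?F])
  also have "val n \<dots> = val n (?F * (?u * ?v))
      + Polynomial.smult ?c (val n (?F * (?u * (yh_e d i * (yh_g i * ?v)))))"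
    using in_YF by (subst val_add) (simp_all add: val_scalar)
  also have "val n (?F * (?u * (yh_e d i * (yh_g i * ?v)))) = val n (?F * (?u * (yh_g i * ?v)))"
    using assms in_YF by (intro val_cong yokonuma_hecke.block_e_cancel[OF yh root]) simp_all
  finally show ?thesis
    by (simp add: block_trace_def mult.assoc)
qed

lemma block_trace_inverse:
  assumes "1 \<le> i" "i < n" "u \<in> braid_words n" "v \<in> braid_words n"
  shows "block_trace r n (u @ [Sigma_inv i] @ v)
    = block_trace r n (u @ [Sigma i] @ v) - [:q - inverse q:] * block_trace r n (u @ v)"
proof -
  let ?F = "yh_block d r n" and ?u = "braid_elem d q u" and ?v = "braid_elem d q v"
  let ?c = "q - inverse q"
  have in_YF: "?u \<in> YF n" "?v \<in> YF n" "yh_g i \<in> YF n" "yh_e d i \<in> YF n"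
    using assms by simp_all
  have "?F * (?u * ((yh_g i - fa_scalar ?c * yh_e d i) * ?v))
      = ?F * (?u * (yh_g i * ?v)) - fa_scalar ?c * (?F * (?u * (yh_e d i * ?v)))"
    by (simp only: left_diff_distrib right_diff_distrib mult.assoc fa_scalar_left_commute[of ?u]
        fa_scalar_left_commute[of ?F])
  also have "val n \<dots> = val n (?F * (?u * (yh_g i * ?v)))
      - Polynomial.smult ?c (val n (?F * (?u * (yh_e d i * ?v))))"
    using in_YF by (subst val_diff) (simp_all add: val_scalar)
  also have "val n (?F * (?u * (yh_e d i * ?v))) = val n (?F * (?u * ?v))"
    using assms in_YF by (intro val_cong yokonuma_hecke.block_e_cancel[OF yh root]) simp_all
  finally show ?thesis
    by (simp add: block_trace_def mult.assoc)
qed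

lemma block_trace_hecke: "hecke_functional [:q - inverse q:] n (\<lambda>w. block_trace r n (map Sigma w))"
  unfolding hecke_functional_def
proof (intro ballI conjI allI impI)
  fix u v assume uv: "u \<in> lists {1..<n}" "v \<in> lists {1..<n}"
  show "block_trace r n (map Sigma (u @ [i, i] @ v)) = block_trace r n (map Sigma (u @ v))
      + [:q - inverse q:] * block_trace r n (map Sigma (u @ [i] @ v))" if "i \<in> {1..<n}" for i
    using block_trace_quadratic[of i n "map Sigma u" "map Sigma v"] uv that by simp
  show "block_trace r n (map Sigma (u @ [Suc i, i, Suc i] @ v))
      = block_trace r n (map Sigma (u @ [i, Suc i, i] @ v))" if "1 \<le> i \<and> Suc i < n" for i
  proof -
    have "yh_cong d q n (yh_g (Suc i) * yh_g i * yh_g (Suc i)) (yh_g i * yh_g (Suc i) * yh_g i)"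
      using that by (intro yh_cong_rel yh_rel.braid) auto
    from val_block_cong[OF _ _ this, of "map Sigma u" "map Sigma v" r] show ?thesis
      using uv by (simp add: block_trace_def mult.assoc)
  qed
  show "block_trace r n (map Sigma (u @ [j, i] @ v)) = block_trace r n (map Sigma (u @ [i, j] @ v))"
    if "1 \<le> i \<and> Suc i < j \<and> j < n" for i j
  proof -
    have "yh_cong d q n (yh_g j * yh_g i) (yh_g i * yh_g j)"
      using that by (intro yh_cong_rel yh_rel.far_comm) auto
    from val_block_cong[OF _ _ this, of "map Sigma u" "map Sigma v" r] show ?thesis
      using uv by (simp add: block_trace_def mult.assoc)
  qed
qed

text \<open>Cyclicity is inherited from the trace because the idempotent commutes with braids.\<close>

lemma block_trace_cyclic:
  assumes u: "u \<in> braid_words n" and v: "v \<in> braid_words n"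
  shows "block_trace r n (u @ v) = block_trace r n (v @ u)"
proof -
  let ?F = "yh_block d r n" and ?u = "braid_elem d q u" and ?v = "braid_elem d q v"
  have "val n (?F * ?u * ?v) = val n (?v * ?F * ?u)"
    using val_comm[of "?F * ?u" n ?v] u v by (simp add: mult.assoc)
  also have "\<dots> = val n (?F * ?v * ?u)"
    using u v
    by (intro val_cong yh_cong_mult_right[OF _ yh_cong_sym[OF yokonuma_hecke.block_braid_comm[OF yh root v]]])
      simp_all
  finally show ?thesis
    by (simp add: block_trace_def mult.assoc)
qed

text \<open>
  A braid on the first \<open>n\<close> strands does not move the last one, so the projection on the new strand
  can be put at the right end, where the trace rule for framings applies.
\<close>

lemma block_Suc_braid:
  assumes "w \<in> braid_words n"
  shows "yh_cong d q (Suc n) (yh_block d r (Suc n) * braid_elem d q w)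
    (yh_block d r n * braid_elem d q w * yh_proj d r (Suc n))"
proof -
  have "yh_cong d q (Suc n) (yh_proj d r (Suc n) * braid_elem d q w)
      (braid_elem d q w * yh_proj d r (Suc n))"
    using yokonuma_hecke.proj_braid[OF yh braid_words_Suc[OF assms], where j = "Suc n" and r = r and q = q]
    by (simp add: braid_perm_above[OF assms])
  from yh_cong_mult_left[OF YF_mono[OF yh_block_in_YF] this] show ?thesis
    by (simp add: yh_block_Suc mult.assoc)
qed

lemma block_trace_Suc:
  assumes "w \<in> braid_words n"
  shows "block_trace r (Suc n) w = [:weight r:] * block_trace r n w"
  using val_cong[OF block_Suc_braid[OF assms]] assms
  by (simp add: block_trace_def val_proj)

text \<open>
  Here the new projection meets \<open>yh_g n\<close>, which turns it into one on strand \<open>n\<close>; by cyclicity it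
  reaches the idempotent of the old strands and is absorbed. So no factor \<open>weight r\<close> arises.
\<close>

lemma block_trace_markov:
  assumes n: "n \<ge> 1" and w: "w \<in> braid_words n"
  shows "block_trace r (Suc n) (w @ [Sigma n]) = [:0, 1:] * block_trace r n w"
proof -
  let ?F = "yh_block d r n" and ?w = "braid_elem d q w" and ?P = "yh_proj d r"
  have F: "?F \<in> YF (Suc n)" and w': "?w \<in> YF (Suc n)" and g: "yh_g n \<in> YF (Suc n)" and P: "?P n \<in> YF (Suc n)"
    using n YF_mono[OF yh_block_in_YF] YF_mono[OF braid_elem_in_YF[OF w]] by auto
  have Pg: "yh_cong d q (Suc n) (?P (Suc n) * yh_g n) (yh_g n * ?P n)"
    using yokonuma_hecke.proj_letter[OF yh, where l = "Sigma n" and n = "Suc n" and j = "Suc n" and q = q and r = r] n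
    by (simp add: braid_words_def)
  have "block_trace r (Suc n) (w @ [Sigma n])
      = val (Suc n) (yh_block d r (Suc n) * ?w * yh_g n)"
    by (simp add: block_trace_def mult.assoc)
  also have "\<dots> = val (Suc n) (?F * ?w * ?P (Suc n) * yh_g n)"
    by (rule val_cong[OF yh_cong_mult_right[OF g block_Suc_braid[OF w]]])
  also have "\<dots> = val (Suc n) (?F * ?w * (?P (Suc n) * yh_g n))"
    by (simp only: mult.assoc)
  also have "\<dots> = val (Suc n) (?F * ?w * (yh_g n * ?P n))"
    using F w' by (intro val_cong yh_cong_mult_left[OF _ Pg]) simp
  also have "\<dots> = val (Suc n) (?P n * ?F * (?w * yh_g n))"
    using val_comm[of "?F * ?w * yh_g n" "Suc n" "?P n"] F w' g P by (simp only: mult.assoc YF_mult)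
  also have "\<dots> = val (Suc n) (?F * (?w * yh_g n))"
    using n w' g
    by (intro val_cong yh_cong_mult_right yh_cong_Suc[OF yokonuma_hecke.proj_block[OF yh root]]) simp_all
  also have "\<dots> = val (Suc n) (?F * ?w * yh_g n)"
    by (simp only: mult.assoc)
  also have "\<dots> = [:0, 1:] * val n (?F * ?w)"
    using n w by (intro val_g YF_mult yh_block_in_YF) simp_all
  finally show ?thesis
    by (simp only: block_trace_def)
qed

lemma block_trace_ocneanu:
  "ocneanu_family [:q - inverse q:] [:weight r:] [:0, 1:] (block_trace r)"
  by (intro ocneanu_familyI block_trace_hecke block_trace_cyclic block_trace_inverse block_trace_Suc
      block_trace_markov)

lemma block_trace_init: "block_trace r 1 [] = [:weight r:]"
  using val_proj[of 1 0 r] by (simp add: block_trace_def yh_block_Suc yh_block_0 val_1)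

text \<open>
  If strand \<open>x\<close> carries a projection, then, by idempotence, passage through the braid and cyclicity,
  strand \<open>braid_perm \<alpha> x\<close> may be given one as well without changing the trace. For a knot this
  spreads from strand \<open>1\<close> to all strands.
\<close>

lemma val_proj_knot:
  assumes n: "n \<ge> 1" and \<alpha>: "\<alpha> \<in> braid_words n" and knot: "is_knot (braid_closure n \<alpha>)"
  shows "val n (yh_proj d r 1 * braid_elem d q \<alpha>) = block_trace r n \<alpha>"
proof -
  let ?a = "braid_elem d q \<alpha>" and ?\<pi> = "braid_perm \<alpha>"
  have a: "?a \<in> YF n" using \<alpha> by simp
  have perm: "?\<pi> x \<in> {1..n}" if "x \<in> {1..n}" for x
    using imageI[OF that, of ?\<pi>] by (simp only: braid_perm_image[OF \<alpha>])
  have push: "val n (yh_projs d r xs * ?a) = val n (yh_projs d r (?\<pi> x # xs) * ?a)"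
    if xs: "set xs \<subseteq> {1..n}" and x: "x \<in> set xs" for x xs
  proof -
    let ?Q = "yh_projs d r xs"
    have x': "x \<in> {1..n}" using xs x by blast
    have Q: "?Q \<in> YF n" "yh_proj d r x \<in> YF n" "yh_proj d r (?\<pi> x) \<in> YF n"
      using xs x' perm[OF x'] by simp_all
    have "yh_cong d q n ?Q (?Q * yh_proj d r x)"
      by (rule yh_cong_trans[OF yh_cong_sym[OF yokonuma_hecke.proj_absorb[OF yh root x xs]]
            yokonuma_hecke.proj_projs_comm[OF yh x' xs]])
    then have "val n (?Q * ?a) = val n (?Q * yh_proj d r x * ?a)"
      by (intro val_cong yh_cong_mult_right[OF a])
    also have "\<dots> = val n (?Q * (yh_proj d r x * ?a))"
      by (simp only: mult.assoc)
    also have "\<dots> = val n (?Q * (?a * yh_proj d r (?\<pi> x)))"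
      by (intro val_cong yh_cong_mult_left[OF Q(1)] yokonuma_hecke.proj_braid[OF yh \<alpha> x'])
    also have "\<dots> = val n (yh_proj d r (?\<pi> x) * (?Q * ?a))"
      using val_comm[of "?Q * ?a" n "yh_proj d r (?\<pi> x)"] Q a by (simp only: mult.assoc YF_mult)
    finally show ?thesis by (simp add: mult.assoc)
  qed
  have "\<exists>xs. set xs = (\<lambda>i. (?\<pi> ^^ i) 1) ` {..m} \<and> set xs \<subseteq> {1..n} \<and>
      val n (yh_proj d r 1 * ?a) = val n (yh_projs d r xs * ?a)" for m
  proof (induction m)
    case 0
    have "val n (yh_proj d r 1 * ?a) = val n (yh_projs d r [1] * ?a)" by simp
    then show ?case using n by (intro exI[of _ "[1]"]) auto
  next
    case (Suc m)
    then obtain xs where xs: "set xs = (\<lambda>i. (?\<pi> ^^ i) 1) ` {..m}" "set xs \<subseteq> {1..n}"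
      "val n (yh_proj d r 1 * ?a) = val n (yh_projs d r xs * ?a)" by blast
    let ?x = "(?\<pi> ^^ m) 1"
    have x: "?x \<in> set xs" using xs(1) by auto
    have "set (?\<pi> ?x # xs) = (\<lambda>i. (?\<pi> ^^ i) 1) ` {..Suc m}"
      by (simp add: xs(1) atMost_Suc)
    moreover have "set (?\<pi> ?x # xs) \<subseteq> {1..n}"
      using xs(2) perm[of ?x] x by auto
    moreover have "val n (yh_proj d r 1 * ?a) = val n (yh_projs d r (?\<pi> ?x # xs) * ?a)"
      using xs(3) push[OF xs(2) x] by simp
    ultimately show ?case by blast
  qed
  moreover obtain m where "{1..n} = (\<lambda>i. (?\<pi> ^^ i) 1) ` {..m}"
    using knot_imp_single_orbit[OF \<alpha> knot n] by blast
  ultimately obtain xs where xs: "set xs = {1..n}"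
    "val n (yh_proj d r 1 * ?a) = val n (yh_projs d r xs * ?a)" by metis
  have "yh_cong d q n (yh_projs d r xs) (yh_block d r n)"
    by (rule yokonuma_hecke.projs_eq_block[OF yh root xs(1)])
  then show ?thesis
    unfolding xs(2) block_trace_def by (intro val_cong yh_cong_mult_right[OF a])
qed

end

lemma trace_knot_eq_sum_blocks:
  assumes n: "n \<ge> 1" and \<alpha>: "\<alpha> \<in> braid_words n" and knot: "is_knot (braid_closure n \<alpha>)"
  shows "tr n (yh_braid d q n \<alpha>) = (\<Sum>k<d. block_trace (unity_root d k) n \<alpha>)"
proof -
  let ?a = "braid_elem d q \<alpha>"
  have "tr n (yh_braid d q n \<alpha>) = val n ((\<Sum>k<d. yh_proj d (unity_root d k) 1) * ?a)"
    by (simp add: val_def yokonuma_hecke.yh_braid_eq[OF yh \<alpha>] sum_proj_unity_roots[OF d_pos])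
  also have "\<dots> = (\<Sum>k<d. val n (yh_proj d (unity_root d k) 1 * ?a))"
    unfolding sum_distrib_right using n \<alpha> by (intro val_sum) simp
  also have "\<dots> = (\<Sum>k<d. block_trace (unity_root d k) n \<alpha>)"
    using assms d_pos by (intro sum.cong val_proj_knot) simp_all
  finally show ?thesis .
qed

end

section \<open>The trace of a knot\<close>

text \<open>
  For roots outside \<open>D\<close> the weight, and with it the value on one strand, is zero, so the functional
  agrees with the zero family by uniqueness. The \<open>|D|\<close> blocks in \<open>D\<close> all contribute \<open>|D|\<^sup>-\<^sup>n\<close> times the
  rescaled Homflypt trace.
\<close>

lemma knot_trace_pcompose:
  assumes d: "d > 0" and D: "D \<subseteq> {0..<d}" "D \<noteq> {}"
    and tr: "specialized_trace d D q tr" and tr1: "specialized_trace 1 {0} q tr1"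
    and n: "n \<ge> 1" and \<alpha>: "\<alpha> \<in> braid_words n" and knot: "is_knot (braid_closure n \<alpha>)"
  shows "tr n (yh_braid d q n \<alpha>)
    = Polynomial.smult (1 / of_nat (card D) ^ (n - 1))
        (pcompose (tr1 n (yh_braid 1 q n \<alpha>)) [:0, of_nat (card D):])"
proof -
  interpret Y: yh_trace d D q tr
    using assms by unfold_locales
  interpret H: yh_trace 1 "{0}" q tr1
    using tr1 by unfold_locales auto
  let ?m = "of_nat (card D) :: complex"
  have fin: "finite D"
    using finite_subset[OF D(1)] by simp
  have m: "?m \<noteq> 0"
    using fin D(2) by simp
  let ?g = "\<lambda>n w. pcompose (H.block_trace 1 n w) [:0, ?m:]"
  have H_weight: "H.weight 1 = 1"
    using H.weight_unity_root[of 0] by simp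
  have g: "ocneanu_family [:q - inverse q:] [:1:] [:0, ?m:] ?g"
    using ocneanu_family_pcompose[OF H.block_trace_ocneanu[of 1, unfolded H_weight], of "[:0, ?m:]"]
    by (simp add: pcompose_pCons)
  have inside: "Y.block_trace (unity_root d k) n \<alpha> = Polynomial.smult (1 / ?m ^ n) (?g n \<alpha>)" if "k \<in> D" for k
  proof -
    have k: "k < d" using that D(1) by auto
    have root: "unity_root d k ^ d = 1" using d by simp
    have weight: "Y.weight (unity_root d k) = 1 / ?m"
      using Y.weight_unity_root[OF k] that by simp
    have family: "ocneanu_family [:q - inverse q:] [:1:] [:0, ?m:]
        (\<lambda>n w. [:?m:] ^ n * Y.block_trace (unity_root d k) n w)"
      using ocneanu_family_scale[OF Y.block_trace_ocneanu[OF root, unfolded weight], of "[:?m:]"] m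
      by simp
    have init: "[:?m:] ^ 1 * Y.block_trace (unity_root d k) 1 [] = ?g 1 []"
      unfolding Y.block_trace_init[OF root] H.block_trace_init[OF power_one] weight H_weight
      using m by simp
    have "[:?m:] ^ n * Y.block_trace (unity_root d k) n \<alpha> = ?g n \<alpha>"
      by (rule ocneanu_family_unique[OF family g init n \<alpha>])
    then have "Polynomial.smult (?m ^ n) (Y.block_trace (unity_root d k) n \<alpha>) = ?g n \<alpha>"
      by (simp add: poly_const_pow)
    then have "Polynomial.smult (1 / ?m ^ n) (?g n \<alpha>)
        = Polynomial.smult (1 / ?m ^ n * ?m ^ n) (Y.block_trace (unity_root d k) n \<alpha>)"
      by (metis smult_smult)
    then show ?thesis using m by simp
  qed
  have outside: "Y.block_trace (unity_root d k) n \<alpha> = 0" if "k < d" "k \<notin> D" for k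
  proof -
    have root: "unity_root d k ^ d = 1" using d by simp
    have weight: "Y.weight (unity_root d k) = 0"
      using Y.weight_unity_root[OF that(1)] that(2) by simp
    have "ocneanu_family [:q - inverse q:] [:0:] [:0, 1:] (\<lambda>n w. 0 :: complex poly)"
      by (rule ocneanu_familyI) (simp_all add: hecke_functional_def)
    moreover have "Y.block_trace (unity_root d k) 1 [] = 0"
      unfolding Y.block_trace_init[OF root] weight by simp
    ultimately show ?thesis
      using ocneanu_family_unique[OF Y.block_trace_ocneanu[OF root, unfolded weight] _ _ n \<alpha>] by blast
  qed
  have "tr n (yh_braid d q n \<alpha>) = (\<Sum>k<d. Y.block_trace (unity_root d k) n \<alpha>)"
    by (rule Y.trace_knot_eq_sum_blocks[OF n \<alpha> knot])
  also have "\<dots> = (\<Sum>k\<in>D. Y.block_trace (unity_root d k) n \<alpha>)"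
    using D(1) outside by (intro sum.mono_neutral_right) auto
  also have "\<dots> = (\<Sum>k\<in>D. Polynomial.smult (1 / ?m ^ n) (?g n \<alpha>))"
    using inside by (rule sum.cong[OF refl])
  also have "\<dots> = Polynomial.smult (?m * (1 / ?m ^ n)) (?g n \<alpha>)"
    by (simp add: of_nat_poly)
  also have "?m * (1 / ?m ^ n) = 1 / ?m ^ (n - 1)"
    using m n by (cases n) simp_all
  also have "H.block_trace 1 n \<alpha> = tr1 n (yh_braid 1 q n \<alpha>)"
    using H.trace_knot_eq_sum_blocks[OF n \<alpha> knot] by simp
  finally show ?thesis .
qed

section \<open>Evaluation in the field of the invariants\<close>

lemma zconst_simps:
  "zconst 0 = 0" "zconst 1 = 1" "zconst (a + b) = zconst a + zconst b" "zconst (a * b) = zconst a * zconst b"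
  by (simp_all add: zconst_def flip: to_ac_add to_ac_mult to_fract_add to_fract_mult one_pCons)

lemma zconst_of_nat: "zconst (of_nat k) = of_nat k"
  by (induction k) (simp_all add: zconst_simps)

lemma zconst_power: "zconst (a ^ k) = zconst a ^ k"
  by (induction k) (simp_all add: zconst_simps)

lemma zconst_inverse_of_nat:
  assumes "k > 0"
  shows "zconst (1 / of_nat k) = 1 / of_nat k"
proof -
  have "zconst (1 / of_nat k) * zconst (of_nat k) = 1"
    using assms by (simp add: zconst_simps flip: zconst_simps(4))
  then show ?thesis
    by (simp add: zconst_of_nat nonzero_eq_divide_eq) (metis mult_zero_right nonzero_eq_divide_eq zero_neq_one)
qed

lemma map_poly_zconst_pCons: "map_poly zconst (pCons a p) = pCons (zconst a) (map_poly zconst p)"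
  by (simp add: map_poly_pCons zconst_simps)

lemma eval_zconst_smult:
  "poly (map_poly zconst (Polynomial.smult a p)) w = zconst a * poly (map_poly zconst p) w"
proof -
  have "map_poly zconst (Polynomial.smult a p) = Polynomial.smult (zconst a) (map_poly zconst p)"
    by (rule poly_eqI) (simp add: coeff_map_poly zconst_simps)
  then show ?thesis by simp
qed

text \<open>
  Substituting \<open>a z\<close> for the indeterminate of a trace polynomial amounts to evaluating it at a
  multiple of the point; this links the polynomial identity with the substitution into the
  invariants.
\<close>

lemma eval_zconst_pcompose_linear:
  "poly (map_poly zconst (pcompose p [:0, a:])) w = poly (map_poly zconst p) (w * zconst a)"
proof (induction p)
  case (pCons b p)
  have "pcompose (pCons b p) [:0, a:] = pCons b (Polynomial.smult a (pcompose p [:0, a:]))"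
    by (simp add: pcompose_pCons)
  then show ?case
    using pCons.IH by (simp add: map_poly_zconst_pCons eval_zconst_smult mult.assoc)
qed simp

theorem theorem1:
  fixes d n :: nat and D :: "nat set" and q :: complex
    and tr tr\<^sub>1 :: "nat \<Rightarrow> yh_gen free_alg set \<Rightarrow> complex poly"
    and s :: zfield and \<alpha> :: "braid_letter list"
  assumes "d > 0" and "D \<subseteq> {0..<d}" and "D \<noteq> {}" and "q \<noteq> 0"
    and "specialized_trace d D q tr"
    and "specialized_trace 1 {0} q tr\<^sub>1"
    and "s ^ 2 = lambda D q zvar"
    and "n \<ge> 1" and "\<alpha> \<in> braid_words n"
    and "is_knot (braid_closure n \<alpha>)"
  shows "Theta d q tr zvar s n \<alpha> = Theta 1 q tr\<^sub>1 (zvar * of_nat (card D)) s n \<alpha> \<and>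
         Theta 1 q tr\<^sub>1 (zvar * of_nat (card D)) s n \<alpha>
           = Homflypt q tr\<^sub>1 (zvar * of_nat (card D)) s n \<alpha>"
proof
  let ?m = "card D"
  have m: "?m > 0"
    using assms(2,3) finite_subset[OF assms(2)] by (simp add: card_gt_0_iff)
  have "poly (map_poly zconst (tr n (yh_braid d q n \<alpha>))) zvar
      = (1 / of_nat ?m) ^ (n - 1)
        * poly (map_poly zconst (tr\<^sub>1 n (yh_braid 1 q n \<alpha>))) (zvar * of_nat ?m)"
    using knot_trace_pcompose[OF assms(1-3,5,6,8-10)] zconst_inverse_of_nat[OF m]
    by (simp add: eval_zconst_smult eval_zconst_pcompose_linear zconst_of_nat zconst_power
        flip: power_one_over)
  moreover have "1 / (zvar * of_nat ?m * s) = 1 / (zvar * s) * (1 / of_nat ?m)"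
    by simp
  ultimately show "Theta d q tr zvar s n \<alpha> = Theta 1 q tr\<^sub>1 (zvar * of_nat ?m) s n \<alpha>"
    unfolding Theta_def by (simp only: power_mult_distrib mult.assoc mult.left_commute)
qed (simp add: Homflypt_def)

end
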